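(* Let $n\ge2$, $2\le d\le n$, and $1\le k \le n(n-d+1)$ be integers. Then $$\delta_q^{\mathrm{Her}}(n \times n, k, d) \in O\left(q^{n^2-k+1-(d-1)(2n-d+1)}\right) \quad \text{as } q \to +\infty.$$ Moreover, $\lim_{q \to+\infty}\delta^{\mathrm{Her}}_q(n \times n,k,d)=1$ if $k < n^2+1-(d-1)(2n-d+1)$, and $=0$ if $k > n^2+1-(d-1)(2n-d+1)$.
   Context: For a prime power $q$, $\mathrm{Her}_n(q^2)$ is the set of Hermitian matrices in $\mathbb{F}_{q^2}^{n\times n}$ ($M=M^*$, where $M^*$ is the transpose of $M$ with $x\mapsto x^q$ applied entrywise), an $\mathbb{F}_q$-space of dimension $n^2$. $\delta^{\mathrm{Her}}_q(n\times n,k,d)$ is the number of $k$-dimensional $\mathbb{F}_q$-subspaces of $\mathrm{Her}_n(q^2)$ in which every nonzero matrix has rank at least $d$, divided by the number of all $k$-dimensional $\mathbb{F}_q$-subspaces of $\mathrm{Her}_n(q^2)$. Limits are over prime powers $q$ with $n,k,d$ fixed. *)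

theory Defs
  imports
    "Jordan_Normal_Form.Missing_VectorSpace"
    "HOL-Number_Theory.Prime_Powers"
    "HOL-Library.Landau_Symbols"
begin

text \<open>
  Throughout, \<open>K\<close> is a field with \<open>q\<^sup>2\<close> elements. A vector of length \<open>n\<close> over \<open>K\<close> is an
  extensional function on \<open>{..<n}\<close>, and an \<open>n \<times> n\<close> matrix over \<open>K\<close> is an extensional function on
  \<open>{..<n} \<times> {..<n}\<close>; both are elements of the library's \<open>ring.func_space\<close>.
\<close>

abbreviation vec_module :: "'a ring \<Rightarrow> nat \<Rightarrow> ('a, nat \<Rightarrow> 'a) module" where
  "vec_module K n \<equiv> ring.func_space K {..<n}"

abbreviation mat_module :: "'a ring \<Rightarrow> nat \<Rightarrow> ('a, nat \<times> nat \<Rightarrow> 'a) module" where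
  "mat_module K n \<equiv> ring.func_space K ({..<n} \<times> {..<n})"

definition mat_col :: "nat \<Rightarrow> (nat \<times> nat \<Rightarrow> 'a) \<Rightarrow> nat \<Rightarrow> (nat \<Rightarrow> 'a)" where
  "mat_col n M j = (\<lambda>i\<in>{..<n}. M (i, j))"

definition mat_rank :: "'a ring \<Rightarrow> nat \<Rightarrow> (nat \<times> nat \<Rightarrow> 'a) \<Rightarrow> nat" where
  "mat_rank K n M = vectorspace.dim K
     ((vec_module K n)\<lparr>carrier := LinearCombinations.module.span K (vec_module K n) (mat_col n M ` {..<n})\<rparr>)"

text \<open>The subfield \<open>F\<^sub>q\<close> of \<open>K\<close>, i.e. the fixed field of \<open>x \<mapsto> x\<^sup>q\<close>.\<close>

definition base_field :: "'a ring \<Rightarrow> nat \<Rightarrow> 'a ring" where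
  "base_field K q = K\<lparr>carrier := {x \<in> carrier K. x [^]\<^bsub>K\<^esub> q = x}\<rparr>"

definition conj_transpose :: "'a ring \<Rightarrow> nat \<Rightarrow> nat \<Rightarrow> (nat \<times> nat \<Rightarrow> 'a) \<Rightarrow> (nat \<times> nat \<Rightarrow> 'a)" where
  "conj_transpose K q n M = (\<lambda>(i, j)\<in>{..<n} \<times> {..<n}. M (j, i) [^]\<^bsub>K\<^esub> q)"

text \<open>The scalars of \<open>Her\<close> are meant to be restricted to \<open>base_field K q\<close>.\<close>

definition Her :: "'a ring \<Rightarrow> nat \<Rightarrow> nat \<Rightarrow> ('a, nat \<times> nat \<Rightarrow> 'a) module" where
  "Her K q n = (mat_module K n)
     \<lparr>carrier := {M \<in> carrier (mat_module K n). M = conj_transpose K q n M}\<rparr>"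

definition Her_subspaces :: "'a ring \<Rightarrow> nat \<Rightarrow> nat \<Rightarrow> nat \<Rightarrow> (nat \<times> nat \<Rightarrow> 'a) set set" where
  "Her_subspaces K q n k = {W. VectorSpace.subspace (base_field K q) W (Her K q n) \<and>
     vectorspace.dim (base_field K q) ((Her K q n)\<lparr>carrier := W\<rparr>) = k}"

definition delta_Her :: "'a ring \<Rightarrow> nat \<Rightarrow> nat \<Rightarrow> nat \<Rightarrow> nat \<Rightarrow> real" where
  "delta_Her K q n k d =
     real (card {W \<in> Her_subspaces K q n k. \<forall>M\<in>W. M \<noteq> \<zero>\<^bsub>Her K q n\<^esub> \<longrightarrow> d \<le> mat_rank K n M})
     / real (card (Her_subspaces K q n k))"

text \<open>The filter of \<open>q \<rightarrow> \<infinity>\<close> along prime powers \<open>q\<close>.\<close>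

definition primepow_at_top :: "nat filter" where
  "primepow_at_top = inf at_top (principal {q. primepow q})"

end

theory Submission
  imports Defs "HOL-Algebra.Subrings" "HOL-Algebra.Multiplicative_Group"
begin

text \<open>
  Let \<open>B\<close> be the set of nonzero Hermitian matrices of rank at most \<open>d - 1\<close>, and let \<open>X\<close> count the
  elements of \<open>B\<close> in a uniformly random \<open>k\<close>-dimensional subspace \<open>W\<close> of the \<open>n\<^sup>2\<close>-dimensional space
  of Hermitian matrices, so that the density is the probability of \<open>X = 0\<close>. The probability that
  \<open>W\<close> contains given independent vectors \<open>v\<^sub>1, \<dots>, v\<^sub>j\<close> depends only on \<open>j\<close>: it is
  \<open>p = (q\<^sup>k - 1) / (q^n\<^sup>2 - 1)\<close> for \<open>j = 1\<close> and at most \<open>p\<^sup>2\<close> for \<open>j = 2\<close>. As \<open>B\<close> is closed under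
  nonzero scalars, the first moment gives \<open>P(X > 0) \<le> |B| p / (q - 1)\<close>, and Chebyshev's inequality
  gives \<open>P(X = 0) \<le> (q - 1) / (|B| p)\<close>. It remains to see that \<open>|B|\<close> has order of magnitude
  \<open>q^((d - 1)(2n - d + 1))\<close>. For the upper bound, a Hermitian matrix whose columns are spanned by
  those with index in \<open>I\<close> is determined by these columns; for the lower bound, the matrices
  \<open>L \<Delta> L\<^sup>*\<close> with \<open>L\<close> unit lower trapezoidal of size \<open>n \<times> (d - 1)\<close> and \<open>\<Delta>\<close> an invertible diagonal
  matrix over \<open>F\<^sub>q\<close> are pairwise distinct.
\<close>

section \<open>The field with \<open>q\<^sup>2\<close> elements\<close>

text \<open>Multiplying the expansion for \<open>n\<close> by \<open>x\<close> raises the index by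
  one, multiplying it by \<open>y\<close> does not; Pascal's rule combines
  \<open>f k \<otimes> x\<close> and \<open>g (Suc k)\<close> into \<open>h (Suc k)\<close>.\<close>

lemma (in cring) add_power_binomial:
  assumes x: "x \<in> carrier R" and y: "y \<in> carrier R"
  shows "(x \<oplus> y) [^] (n::nat) = (\<Oplus>k\<in>{..n}. [(n choose k)] \<cdot> (x [^] k \<otimes> y [^] (n - k)))"
proof (induction n)
  case 0
  show ?case using x y by simp
next
  case (Suc n)
  define f where "f = (\<lambda>k. [(n choose k)] \<cdot> (x [^] k \<otimes> y [^] (n - k)))"
  define g where "g = (\<lambda>k. [(n choose k)] \<cdot> (x [^] k \<otimes> y [^] (Suc n - k)))"
  define h where "h = (\<lambda>k. [(Suc n choose k)] \<cdot> (x [^] k \<otimes> y [^] (Suc n - k)))"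
  have f: "f k \<in> carrier R" and g: "g k \<in> carrier R" and h: "h k \<in> carrier R" for k
    using x y by (auto simp: f_def g_def h_def)
  have fx: "f k \<otimes> x = [(n choose k)] \<cdot> (x [^] Suc k \<otimes> y [^] (n - k))" for k
    using x y by (simp add: f_def add_pow_ldistr add_pow_rdistr m_ac)
  have fy: "f k \<otimes> y = g k" if "k \<le> n" for k
    using x y that by (simp add: f_def g_def add_pow_ldistr add_pow_rdistr m_ac Suc_diff_le)
  have "h (Suc k) = f k \<otimes> x \<oplus> g (Suc k)" if "k \<le> n" for k
    unfolding fx using x y that by (simp add: h_def g_def add.nat_pow_mult)
  hence "(\<Oplus>k\<in>{..n}. h (Suc k)) = (\<Oplus>k\<in>{..n}. f k \<otimes> x \<oplus> g (Suc k))"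
    using x y f g by (intro finsum_cong') (auto simp: Pi_iff)
  also have "\<dots> = (\<Oplus>k\<in>{..n}. f k \<otimes> x) \<oplus> (\<Oplus>k\<in>{..n}. g (Suc k))"
    using x y f g by (intro finsum_addf) (auto simp: Pi_iff)
  finally have H: "(\<Oplus>k\<in>{..n}. h (Suc k)) = (\<Oplus>k\<in>{..n}. f k \<otimes> x) \<oplus> (\<Oplus>k\<in>{..n}. g (Suc k))" .
  have "(\<Oplus>k\<in>{..n}. f k \<otimes> y) = (\<Oplus>k\<in>{..n}. g k)"
    using fy g by (intro finsum_cong') (auto simp: Pi_iff)
  \<comment> \<open>The added term vanishes because \<open>n choose Suc n\<close> is
    \<open>0\<close>; with it in place, the term at \<open>0\<close> can be split off from the other
    end.\<close>
  also have "\<dots> = (\<Oplus>k\<in>{..Suc n}. g k)"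
  proof -
    have "g (Suc n) = \<zero>" using x y by (simp add: g_def binomial_eq_0)
    thus ?thesis using g by (simp add: finsum_Suc Pi_iff)
  qed
  also have "\<dots> = (\<Oplus>k\<in>{..n}. g (Suc k)) \<oplus> g 0"
    using g by (intro finsum_Suc2) auto
  finally have G: "(\<Oplus>k\<in>{..n}. f k \<otimes> y) = (\<Oplus>k\<in>{..n}. g (Suc k)) \<oplus> g 0" .
  have gh: "g 0 = h 0" by (simp add: g_def h_def)
  have c: "g 0 \<in> carrier R" "(\<Oplus>k\<in>{..n}. g (Suc k)) \<in> carrier R" "(\<Oplus>k\<in>{..n}. f k \<otimes> x) \<in> carrier R"
    using f g x y by (auto simp: Pi_iff intro!: finsum_closed)
  have "(x \<oplus> y) [^] Suc n = finsum R f {..n} \<otimes> (x \<oplus> y)"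
    using Suc by (simp add: f_def)
  also have "\<dots> = finsum R f {..n} \<otimes> x \<oplus> finsum R f {..n} \<otimes> y"
    using f x y by (intro r_distr) (auto simp: Pi_iff)
  also have "\<dots> = (\<Oplus>k\<in>{..n}. f k \<otimes> x) \<oplus> (\<Oplus>k\<in>{..n}. f k \<otimes> y)"
    using f x y by (simp add: finsum_ldistr)
  also have "\<dots> = (\<Oplus>k\<in>{..n}. h (Suc k)) \<oplus> h 0"
    unfolding G H gh[symmetric] using c by (simp add: a_assoc)
  also have "\<dots> = finsum R h {..Suc n}"
    using h by (intro finsum_Suc2[symmetric]) auto
  finally show ?case by (simp add: h_def)
qed

text \<open>The binomial coefficients strictly between the two ends are divisible by
  \<open>p\<close>, so only the end terms of the expansion survive.\<close>

lemma (in cring) add_power_prime_char: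
  assumes x: "x \<in> carrier R" and y: "y \<in> carrier R" and p: "prime (p::nat)"
    and char: "\<And>a. a \<in> carrier R \<Longrightarrow> [p] \<cdot> a = \<zero>"
  shows "(x \<oplus> y) [^] p = x [^] p \<oplus> y [^] p"
proof -
  define f where "f = (\<lambda>k. [(p choose k)] \<cdot> (x [^] k \<otimes> y [^] (p - k)))"
  have f: "f k \<in> carrier R" for k using x y by (auto simp: f_def)
  have p0: "p > 0" using p prime_gt_0_nat by blast
  have f0: "f k = \<zero>" if "0 < k" "k < p" for k
  proof -
    have "p dvd p choose k" using p that by (intro dvd_choose_prime) auto
    then obtain c where "p choose k = p * c" by blast
    thus ?thesis using x y char by (simp add: f_def add.nat_pow_pow[symmetric])
  qed
  have "(x \<oplus> y) [^] p = finsum R f {..p}" using add_power_binomial[OF x y] by (simp add: f_def)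
  also have "\<dots> = (\<Oplus>k\<in>{0,p}. f k)"
    using f f0 by (intro add.finprod_mono_neutral_cong_right) auto
  also have "\<dots> = x [^] p \<oplus> y [^] p" using p0 f x y
    by (simp add: f_def) (simp add: a_comm)
  finally show ?thesis .
qed

text \<open>By Lagrange in the additive group, \<open>p ^ m\<close> copies of \<open>\<one>\<close>
  add up to zero. This sum is the \<open>m\<close>-th power of \<open>[p] \<cdot> \<one>\<close>,
  and a field has no nonzero nilpotents, so \<open>p\<close> annihilates the field and the
  \<open>p\<close>-power map is additive. Iterate it \<open>k\<close> times.\<close>

lemma (in field) add_power_order:
  assumes ord: "order R = p ^ m" and p: "prime p"
    and x: "x \<in> carrier R" and y: "y \<in> carrier R"
  shows "(x \<oplus> y) [^] (p ^ k) = x [^] (p ^ k) \<oplus> y [^] (p ^ k)"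
proof -
  have "[(order R)] \<cdot> \<one> = \<zero>"
    using group.pow_order_eq_1[OF a_group, of \<one>] by (simp add: order_def add_pow_def)
  moreover have "([p] \<cdot> \<one>) [^] j = [(p ^ j)] \<cdot> \<one>" for j
    by (induction j) (simp_all add: add_pow_ldistr add_pow_rdistr add.nat_pow_pow mult.commute)
  ultimately have "([p] \<cdot> \<one>) [^] m = \<zero>" using ord by simp
  moreover have "a [^] j \<noteq> \<zero>" if "a \<in> carrier R" "a \<noteq> \<zero>" for a and j :: nat
    using that by (induction j) (auto simp: integral_iff)
  ultimately have p1: "[p] \<cdot> \<one> = \<zero>"
    using add.nat_pow_closed one_closed by blast
  have char: "[p] \<cdot> a = \<zero>" if "a \<in> carrier R" for a
    using add_pow_ldistr[of \<one> a p] p1 that by simp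
  show ?thesis
  proof (induction k)
    case (Suc k)
    have "(x \<oplus> y) [^] (p ^ Suc k) = (x [^] (p ^ k) \<oplus> y [^] (p ^ k)) [^] p"
      using x y Suc by (metis a_closed nat_pow_pow power_Suc2)
    also have "\<dots> = x [^] (p ^ Suc k) \<oplus> y [^] (p ^ Suc k)"
      using add_power_prime_char[OF _ _ p char, of "x [^] (p ^ k)" "y [^] (p ^ k)"] x y
      by (simp add: nat_pow_pow mult.commute)
    finally show ?case .
  qed (use x y in simp)
qed

text \<open>The upper bound is the degree of X^m - 1. Conversely, the multiplicative group is cyclic
  of order \<open>m * e\<close>, and for a generator \<open>a\<close> the elements
  \<open>a [^] (e * i)\<close> with \<open>i < m\<close> are distinct roots.\<close>

lemma (in field) card_roots_of_unity:
  assumes fin: "finite (carrier R)" and ord: "order R - 1 = m * e" and m: "m > 0" and e: "e > 0"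
  shows "card {x \<in> carrier R. x [^] m = \<one>} = m"
proof (rule antisym)
  show "card {x \<in> carrier R. x [^] m = \<one>} \<le> m"
    using num_roots_le_deg[OF fin] m by simp
  interpret G: group "mult_of R" rewrites
      "([^]\<^bsub>mult_of R\<^esub>) = (([^]) :: _ \<Rightarrow> nat \<Rightarrow> _)" and "\<one>\<^bsub>mult_of R\<^esub> = \<one>"
    by (rule field_mult_group) (simp_all add: fun_eq_iff nat_pow_def)
  obtain a where a: "a \<in> carrier (mult_of R)"
    and gen: "carrier (mult_of R) = {a [^] i | i::nat. i \<in> UNIV}"
    using finite_field_mult_group_has_gen[OF fin] by blast
  have finG: "finite (carrier (mult_of R))" using fin by simp
  have ordG: "order (mult_of R) = m * e" using order_mult_of[OF fin] ord by simp
  have "carrier (mult_of R) = (\<lambda>i. a [^] i) ` {0..G.ord a - 1}"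
    using gen G.ord_elems[OF finG a] by auto
  hence "order (mult_of R) \<le> card {0..G.ord a - 1}"
    unfolding order_def by (metis card_image_le finite_atLeastAtMost)
  hence orda: "G.ord a = m * e"
    using G.ord_le_group_order[OF finG a] G.ord_ge_1[OF finG a] ordG by simp
  have "inj_on (\<lambda>i. a [^] (e * i)) {..<m}"
  proof (rule inj_onI)
    fix i j assume ij: "i \<in> {..<m}" "j \<in> {..<m}" and eq: "a [^] (e * i) = a [^] (e * j)"
    have "e * i \<in> {0..G.ord a - 1}" "e * j \<in> {0..G.ord a - 1}"
      using ij e unfolding orda by (simp_all add: mult.commute[of m] less_Suc_eq_le[symmetric] m)
    hence "e * i = e * j" using G.ord_inj[OF a] eq unfolding inj_on_def by blast
    thus "i = j" using e by simp
  qed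
  moreover have "(\<lambda>i. a [^] (e * i)) ` {..<m} \<subseteq> {x \<in> carrier R. x [^] m = \<one>}"
  proof clarify
    fix i :: nat assume "i < m"
    have aR: "a \<in> carrier R" using a by simp
    have "(a [^] (e * i)) [^] m = (a [^] (m * e)) [^] i"
      using aR by (simp add: nat_pow_pow ac_simps)
    also have "\<dots> = \<one>" using G.pow_ord_eq_1[OF a] orda by simp
    finally show "a [^] (e * i) \<in> carrier R \<and> (a [^] (e * i)) [^] m = \<one>" using aR by simp
  qed
  ultimately show "m \<le> card {x \<in> carrier R. x [^] m = \<one>}"
    using fin card_inj_on_le[of "\<lambda>i. a [^] (e * i)" "{..<m}" "{x \<in> carrier R. x [^] m = \<one>}"] by simp
qed

locale hermitian_field = field K for K :: "'a ring" (structure) +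
  fixes q :: nat
  assumes primepow_q: "primepow q" and order_K: "order K = q\<^sup>2"
begin

text \<open>The conjugation of \<open>K\<close> over its subfield with \<open>q\<close>
  elements.\<close>

abbreviation bar :: "'a \<Rightarrow> 'a" where "bar x \<equiv> x [^] q"
abbreviation "Fq \<equiv> {x \<in> carrier K. bar x = x}"

lemma q_gt_1: "q > 1"
  using primepow_gt_Suc_0[OF primepow_q] by simp

lemma card_K: "card (carrier K) = q\<^sup>2"
  using order_K by (simp add: order_def)

lemma finite_K: "finite (carrier K)"
  using card_K q_gt_1 by (metis card.infinite less_nat_zero_code pos2 power_eq_0_iff)

text \<open>For \<open>q = p ^ m\<close>, conjugation is an iterate of the \<open>p\<close>-power
  map, and the order of \<open>K\<close> is a power of \<open>p\<close>.\<close>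

lemma bar_add:
  assumes "x \<in> carrier K" "y \<in> carrier K"
  shows "bar (x \<oplus> y) = bar x \<oplus> bar y"
proof -
  obtain p m where pm: "prime p" "q = p ^ m"
    using primepow_q by (auto simp: primepow_def)
  have "order K = p ^ (m * 2)" using order_K pm by (simp add: power_mult)
  from add_power_order[OF this pm(1) assms] show ?thesis using pm by simp
qed

text \<open>A nonzero \<open>x\<close> satisfies \<open>x [^] (q\<^sup>2 - 1) = \<one>\<close> by
  Lagrange in the multiplicative group.\<close>

lemma bar_bar:
  assumes x: "x \<in> carrier K"
  shows "bar (bar x) = x"
proof (cases "x = \<zero>")
  case True
  thus ?thesis using q_gt_1 by (simp add: nat_pow_zero)
next
  case False
  have "x [^] (q\<^sup>2 - 1) = \<one>"
    using group.pow_order_eq_1[OF field_mult_group, of x] x False order_mult_of[OF finite_K] order_K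
    by (simp add: nat_pow_mult_of)
  moreover have "q * q = Suc (q\<^sup>2 - 1)" using q_gt_1 by (simp add: power2_eq_square)
  ultimately have "x [^] (q * q) = x" using x by simp
  thus ?thesis using x by (simp add: nat_pow_pow)
qed

text \<open>This supplies the homomorphism rules for conjugating sums termwise, in particular
  \<open>bar.hom_finsum\<close>.\<close>

sublocale bar: ring_hom_cring K K bar
  using q_gt_1 by unfold_locales (auto intro!: ring_hom_memI bar_add simp: nat_pow_distrib)

text \<open>Besides zero, the fixed points of \<open>bar\<close> are the roots of unity of order
  dividing \<open>q - 1\<close>, and \<open>q - 1\<close> divides the order
  \<open>q\<^sup>2 - 1\<close> of the multiplicative group.\<close>

lemma card_Fq: "card Fq = q"
proof -
  have "order K - 1 = (q - 1) * (q + 1)"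
    using order_K by (simp add: power2_eq_square algebra_simps)
  hence card: "card {x \<in> carrier K. x [^] (q - 1) = \<one>} = q - 1"
    using q_gt_1 by (intro card_roots_of_unity[OF finite_K]) auto
  have "bar x = x \<longleftrightarrow> x = \<zero> \<or> x [^] (q - 1) = \<one>" if x: "x \<in> carrier K" for x
  proof -
    have "q = Suc (q - 1)" using q_gt_1 by simp
    hence e: "bar x = x [^] (q - 1) \<otimes> x" using nat_pow_Suc[of x "q - 1"] by simp
    show ?thesis
    proof (cases "x = \<zero>")
      case False
      have "x [^] (q - 1) \<otimes> x = \<one> \<otimes> x \<longleftrightarrow> x [^] (q - 1) = \<one>"
        using m_rcancel[OF False x, of "x [^] (q - 1)" \<one>] x by simp
      thus ?thesis using e False x by simp
    qed (use q_gt_1 in \<open>simp add: nat_pow_zero\<close>)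
  qed
  hence "Fq = insert \<zero> {x \<in> carrier K. x [^] (q - 1) = \<one>}" by auto
  moreover have "\<zero> \<notin> {x \<in> carrier K. x [^] (q - 1) = \<one>}"
    using q_gt_1 by (simp add: nat_pow_zero)
  ultimately show ?thesis using card finite_K q_gt_1 by simp
qed

lemma subfield_Fq: "subfield Fq K"
proof (rule subfieldI')
  show "subring Fq K"
    by (rule subringI) (auto simp: bar_add nat_pow_distrib)
  show "inv k \<in> Fq" if "k \<in> Fq - {\<zero>}" for k
  proof -
    have k: "k \<in> carrier K" "k \<noteq> \<zero>" "bar k = k" using that by auto
    have i: "inv k \<in> carrier K" using k field_Units by auto
    have "bar (inv k) \<otimes> k = bar (inv k \<otimes> k)"
      using k i by (simp add: nat_pow_distrib)
    also have "\<dots> = \<one>" using k field_Units by simp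
    finally have "bar (inv k) = inv k"
      using k i by (metis Diff_iff Units_r_inv bar.hom_closed field_Units inv_unique empty_iff insert_iff)
    thus ?thesis using i by simp
  qed
qed

lemma base_field_eq: "base_field K q = K\<lparr>carrier := Fq\<rparr>"
  by (simp add: base_field_def)

lemma field_base_field: "field (base_field K q)"
  using subfield_iff(2)[OF subfield_Fq] by (simp add: base_field_eq)

end

section \<open>Subspaces of finite vector spaces\<close>

context vectorspace
begin

text \<open>Coordinates with respect to a finite basis give a bijection. From here on, dimensions
  are expressed through cardinalities.\<close>

lemma card_eq_power_dim:
  assumes fin: "finite (carrier V)"
  shows "card (carrier V) = card (carrier K) ^ dim"
proof -
  have "gen_set (carrier V)"
    using span_is_subset2[of "carrier V"] in_own_span[of "carrier V"] by auto
  hence "fin_dim" unfolding fin_dim_def using fin by blast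
  then obtain b where b: "finite b" "basis b" using finite_basis_exists by blast
  have bV: "b \<subseteq> carrier V" using b by (simp add: basis_def)
  have u: "\<exists>!a. a \<in> b \<rightarrow>\<^sub>E carrier K \<and> lincomb a b = v" if "v \<in> carrier V" for v
    using basis_criterion[OF b(1) bV] b(2) that by blast
  have cl: "lincomb a b \<in> carrier V" if "a \<in> b \<rightarrow>\<^sub>E carrier K" for a
    using that bV by (auto simp: PiE_def)
  have "bij_betw (\<lambda>a. lincomb a b) (b \<rightarrow>\<^sub>E carrier K) (carrier V)"
    unfolding bij_betw_def
  proof
    show "inj_on (\<lambda>a. lincomb a b) (b \<rightarrow>\<^sub>E carrier K)"
      by (rule inj_onI) (use u cl in blast)
    show "(\<lambda>a. lincomb a b) ` (b \<rightarrow>\<^sub>E carrier K) = carrier V"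
      using u cl by blast
  qed
  hence "card (carrier V) = card (b \<rightarrow>\<^sub>E carrier K)" by (simp add: bij_betw_same_card)
  also have "\<dots> = card (carrier K) ^ dim" using b dim_basis by (simp add: card_PiE)
  finally show ?thesis .
qed

lemma card_subspace:
  assumes "VectorSpace.subspace K W V" and "finite (carrier V)"
  shows "card W = card (carrier K) ^ vectorspace.dim K (V\<lparr>carrier := W\<rparr>)"
proof -
  interpret W: vectorspace K "vs W" using subspace_is_vs[OF assms(1)] .
  have "W \<subseteq> carrier V" using assms(1) by (auto simp: VectorSpace.subspace_def submodule_def)
  hence "finite W" using assms(2) by (rule finite_subset)
  thus ?thesis using W.card_eq_power_dim by simp
qed

text \<open>For a subspace \<open>U\<close> this is the span of \<open>U\<close> and
  \<open>v\<close>, written as the image of \<open>U \<times> carrier K\<close> so that it can be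
  counted.\<close>

definition adjoin :: "'c set \<Rightarrow> 'c \<Rightarrow> 'c set" where
  "adjoin U v = (\<lambda>(u, c). u \<oplus>\<^bsub>V\<^esub> c \<odot>\<^bsub>V\<^esub> v) ` (U \<times> carrier K)"

lemma subspaceD:
  assumes "VectorSpace.subspace K U V"
  shows "U \<subseteq> carrier V" "\<zero>\<^bsub>V\<^esub> \<in> U"
    "\<And>u v. u \<in> U \<Longrightarrow> v \<in> U \<Longrightarrow> u \<oplus>\<^bsub>V\<^esub> v \<in> U"
    "\<And>c v. c \<in> carrier K \<Longrightarrow> v \<in> U \<Longrightarrow> c \<odot>\<^bsub>V\<^esub> v \<in> U"
    "\<And>u v. u \<in> U \<Longrightarrow> v \<in> U \<Longrightarrow> u \<ominus>\<^bsub>V\<^esub> v \<in> U"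
proof -
  show U: "U \<subseteq> carrier V" and "\<zero>\<^bsub>V\<^esub> \<in> U"
    and add: "\<And>u v. u \<in> U \<Longrightarrow> v \<in> U \<Longrightarrow> u \<oplus>\<^bsub>V\<^esub> v \<in> U"
    and sm: "\<And>c v. c \<in> carrier K \<Longrightarrow> v \<in> U \<Longrightarrow> c \<odot>\<^bsub>V\<^esub> v \<in> U"
    using assms by (auto simp: VectorSpace.subspace_def submodule_def)
  fix u v assume "u \<in> U" "v \<in> U"
  moreover from this have "\<ominus>\<^bsub>V\<^esub> v \<in> U"
    using sm[of "\<ominus>\<^bsub>K\<^esub> \<one>\<^bsub>K\<^esub>" v] U smult_minus_1[of v] by auto
  ultimately show "u \<ominus>\<^bsub>V\<^esub> v \<in> U" using add by (simp add: a_minus_def)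
qed

lemma subspaceI:
  assumes "U \<subseteq> carrier V" "\<zero>\<^bsub>V\<^esub> \<in> U"
    "\<And>u v. u \<in> U \<Longrightarrow> v \<in> U \<Longrightarrow> u \<oplus>\<^bsub>V\<^esub> v \<in> U"
    "\<And>c v. c \<in> carrier K \<Longrightarrow> v \<in> U \<Longrightarrow> c \<odot>\<^bsub>V\<^esub> v \<in> U"
  shows "VectorSpace.subspace K U V"
  using assms vectorspace_axioms module_axioms by (auto simp: VectorSpace.subspace_def submodule_def)

lemma adjoin_superset:
  assumes "VectorSpace.subspace K U V" "v \<in> carrier V"
  shows "U \<subseteq> adjoin U v" "v \<in> adjoin U v"
proof -
  note U = subspaceD[OF assms(1)]
  show "U \<subseteq> adjoin U v"
  proof
    fix u assume "u \<in> U"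
    thus "u \<in> adjoin U v" unfolding adjoin_def
      using U assms(2) by (intro image_eqI[of _ _ "(u, \<zero>\<^bsub>K\<^esub>)"]) auto
  qed
  show "v \<in> adjoin U v" unfolding adjoin_def
    using U assms(2) by (intro image_eqI[of _ _ "(\<zero>\<^bsub>V\<^esub>, \<one>\<^bsub>K\<^esub>)"]) auto
qed

lemma adjoin_least:
  assumes "VectorSpace.subspace K W V" "U \<subseteq> W" "v \<in> W"
  shows "adjoin U v \<subseteq> W"
  using subspaceD[OF assms(1)] assms(2,3) by (auto simp: adjoin_def)

lemma subspace_adjoin:
  assumes U: "VectorSpace.subspace K U V" and v: "v \<in> carrier V"
  shows "VectorSpace.subspace K (adjoin U v) V"
proof (rule subspaceI)
  note UD = subspaceD[OF U]
  show "adjoin U v \<subseteq> carrier V" using UD v by (auto simp: adjoin_def)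
  show "\<zero>\<^bsub>V\<^esub> \<in> adjoin U v" using adjoin_superset[OF U v] UD by auto
next
  note UD = subspaceD[OF U]
  fix x y assume "x \<in> adjoin U v" "y \<in> adjoin U v"
  then obtain a b c d where *: "a \<in> U" "b \<in> carrier K" "x = a \<oplus>\<^bsub>V\<^esub> b \<odot>\<^bsub>V\<^esub> v"
    "c \<in> U" "d \<in> carrier K" "y = c \<oplus>\<^bsub>V\<^esub> d \<odot>\<^bsub>V\<^esub> v" by (auto simp: adjoin_def)
  have "x \<oplus>\<^bsub>V\<^esub> y = (a \<oplus>\<^bsub>V\<^esub> c) \<oplus>\<^bsub>V\<^esub> (b \<oplus>\<^bsub>K\<^esub> d) \<odot>\<^bsub>V\<^esub> v"
    using * UD(1) v by (auto simp: smult_l_distr M.a_ac subset_iff)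
  thus "x \<oplus>\<^bsub>V\<^esub> y \<in> adjoin U v" unfolding adjoin_def
    using * UD by (intro image_eqI[of _ _ "(a \<oplus>\<^bsub>V\<^esub> c, b \<oplus>\<^bsub>K\<^esub> d)"]) auto
next
  note UD = subspaceD[OF U]
  fix c x assume c: "c \<in> carrier K" and "x \<in> adjoin U v"
  then obtain a b where *: "a \<in> U" "b \<in> carrier K" "x = a \<oplus>\<^bsub>V\<^esub> b \<odot>\<^bsub>V\<^esub> v"
    by (auto simp: adjoin_def)
  have "c \<odot>\<^bsub>V\<^esub> x = (c \<odot>\<^bsub>V\<^esub> a) \<oplus>\<^bsub>V\<^esub> (c \<otimes>\<^bsub>K\<^esub> b) \<odot>\<^bsub>V\<^esub> v"
    using * c UD(1) v by (auto simp: smult_r_distr smult_assoc1 subset_iff)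
  thus "c \<odot>\<^bsub>V\<^esub> x \<in> adjoin U v" unfolding adjoin_def
    using * c UD by (intro image_eqI[of _ _ "(c \<odot>\<^bsub>V\<^esub> a, c \<otimes>\<^bsub>K\<^esub> b)"]) auto
qed

text \<open>If two representations of a vector had different coefficients of \<open>v\<close>,
  dividing by their difference would put \<open>v\<close> into \<open>U\<close>.\<close>

lemma card_adjoin:
  assumes U: "VectorSpace.subspace K U V" and v: "v \<in> carrier V" and vU: "v \<notin> U"
  shows "card (adjoin U v) = card U * card (carrier K)"
proof -
  note UD = subspaceD[OF U]
  have "inj_on (\<lambda>(u, c). u \<oplus>\<^bsub>V\<^esub> c \<odot>\<^bsub>V\<^esub> v) (U \<times> carrier K)"
  proof (rule inj_onI, clarify)
    fix a b c d assume *: "a \<in> U" "b \<in> carrier K" "c \<in> U" "d \<in> carrier K"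
      and eq: "a \<oplus>\<^bsub>V\<^esub> b \<odot>\<^bsub>V\<^esub> v = c \<oplus>\<^bsub>V\<^esub> d \<odot>\<^bsub>V\<^esub> v"
    have cl: "a \<in> carrier V" "c \<in> carrier V" "b \<odot>\<^bsub>V\<^esub> v \<in> carrier V" "d \<odot>\<^bsub>V\<^esub> v \<in> carrier V"
      using * UD(1) v by auto
    have "(b \<ominus>\<^bsub>K\<^esub> d) \<odot>\<^bsub>V\<^esub> v = b \<odot>\<^bsub>V\<^esub> v \<ominus>\<^bsub>V\<^esub> d \<odot>\<^bsub>V\<^esub> v"
      using * v by (simp add: a_minus_def smult_l_distr smult_l_minus)
    also have "\<dots> = c \<ominus>\<^bsub>V\<^esub> a"
    proof -
      have "b \<odot>\<^bsub>V\<^esub> v = (c \<oplus>\<^bsub>V\<^esub> d \<odot>\<^bsub>V\<^esub> v) \<ominus>\<^bsub>V\<^esub> a"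
        using cl eq[symmetric] by (simp add: a_minus_def M.a_ac M.r_neg1 M.r_neg2)
      thus ?thesis using cl by (simp add: a_minus_def M.a_ac M.r_neg M.r_neg1 M.r_neg2)
    qed
    finally have bd: "(b \<ominus>\<^bsub>K\<^esub> d) \<odot>\<^bsub>V\<^esub> v = c \<ominus>\<^bsub>V\<^esub> a" .
    have "b = d"
    proof (rule ccontr)
      assume "b \<noteq> d"
      hence n0: "b \<ominus>\<^bsub>K\<^esub> d \<noteq> \<zero>\<^bsub>K\<^esub>" using * by simp
      have "v = inv\<^bsub>K\<^esub> (b \<ominus>\<^bsub>K\<^esub> d) \<odot>\<^bsub>V\<^esub> (c \<ominus>\<^bsub>V\<^esub> a)"
        using mult_inverse[OF _ v bd n0] * by simp
      moreover have "inv\<^bsub>K\<^esub> (b \<ominus>\<^bsub>K\<^esub> d) \<in> carrier K" using n0 * by auto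
      ultimately have "v \<in> U" using UD(4,5) * by metis
      thus False using vU by simp
    qed
    moreover from this have "a = c" using eq cl by simp
    ultimately show "a = c \<and> b = d" by simp
  qed
  hence "card (adjoin U v) = card (U \<times> carrier K)" unfolding adjoin_def by (rule card_image)
  thus ?thesis by (simp add: card_cartesian_product)
qed

end

section \<open>Counting subspaces through given vectors, and the moments of a random
  subspace\<close>

lemma real_sum_card_swap:
  assumes "finite A" "finite B"
  shows "(\<Sum>a\<in>A. real (card {b \<in> B. R a b})) = (\<Sum>b\<in>B. real (card {a \<in> A. R a b}))"
proof -
  have "(\<Sum>a\<in>A. card {b \<in> B. R a b}) = (\<Sum>b\<in>B. card {a \<in> A. R a b})"
    by (rule sum_multicount_gen[OF assms]) simp
  thus ?thesis unfolding of_nat_sum[symmetric] by simp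
qed

text \<open>The dimension \<open>N\<close> enters only as the exponent in the cardinality of the
  space.\<close>

locale finite_vectorspace = vectorspace K V for K (structure) and V +
  fixes Q N :: nat
  assumes finite_V: "finite (carrier V)" and card_K: "card (carrier K) = Q" and Q_gt_1: "Q > 1"
    and card_V: "card (carrier V) = Q ^ N"
begin

definition subspaces_over :: "nat \<Rightarrow> 'c set \<Rightarrow> 'c set set" where
  "subspaces_over k U = {W. VectorSpace.subspace K W V \<and> U \<subseteq> W \<and> card W = Q ^ k}"

text \<open>For \<open>j \<le> k \<le> N\<close> this is the Gaussian binomial coefficient of
  \<open>N - j\<close> over \<open>k - j\<close> with base \<open>Q\<close>, before cancelling
  \<open>Q ^ j\<close> in each factor.\<close>

definition num_over :: "nat \<Rightarrow> nat \<Rightarrow> real" where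
  "num_over k j = (\<Prod>i\<in>{j..<k}. (real Q ^ N - real Q ^ i) / (real Q ^ k - real Q ^ i))"

lemma finite_subspace: "VectorSpace.subspace K W V \<Longrightarrow> finite W"
  using subspaceD(1) finite_V finite_subset by blast

lemma finite_subspaces_over: "finite (subspaces_over k U)"
  by (rule finite_subset[of _ "Pow (carrier V)"])
    (use finite_V subspaceD(1) in \<open>auto simp: subspaces_over_def\<close>)

lemma subspaces_over_adjoin:
  assumes "VectorSpace.subspace K U V" "v \<in> carrier V"
  shows "subspaces_over k (adjoin U v) = {W \<in> subspaces_over k U. v \<in> W}"
  using adjoin_superset[OF assms] adjoin_least[of _ U v] by (auto simp: subspaces_over_def)

text \<open>Double counting of the pairs of a subspace \<open>W\<close> over \<open>U\<close> and a
  vector \<open>v\<close> of \<open>W\<close> outside \<open>U\<close>. Each \<open>W\<close> has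
  \<open>Q ^ k - Q ^ j\<close> such vectors, and the \<open>W\<close> belonging to a given
  \<open>v\<close> are those over \<open>adjoin U v\<close>, which the induction on
  \<open>k - j\<close> counts.\<close>

lemma card_subspaces_over:
  assumes "VectorSpace.subspace K U V" "card U = Q ^ j" "j \<le> k"
  shows "real (card (subspaces_over k U)) = num_over k j"
  using assms
proof (induction "k - j" arbitrary: j U)
  case 0
  hence j: "j = k" by simp
  have "subspaces_over k U = {U}"
  proof
    show "subspaces_over k U \<subseteq> {U}"
    proof
      fix W assume W: "W \<in> subspaces_over k U"
      hence "finite W" using finite_subspace by (auto simp: subspaces_over_def)
      hence "W = U" using W 0 j card_subset_eq[of W U] by (auto simp: subspaces_over_def)
      thus "W \<in> {U}" by simp
    qed
  qed (use 0 j in \<open>auto simp: subspaces_over_def\<close>)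
  thus ?case using j by (simp add: num_over_def)
next
  case (Suc m)
  hence jk: "j < k" by simp
  have U: "U \<subseteq> carrier V" "finite U"
    using Suc.prems(1) subspaceD(1) finite_subspace by auto
  have 1: "card {v \<in> carrier V - U. v \<in> W} = Q ^ k - Q ^ j" if "W \<in> subspaces_over k U" for W
  proof -
    have W: "VectorSpace.subspace K W V" "U \<subseteq> W" "card W = Q ^ k"
      using that by (auto simp: subspaces_over_def)
    have "{v \<in> carrier V - U. v \<in> W} = W - U" using subspaceD(1)[OF W(1)] by auto
    thus ?thesis using W U Suc.prems by (simp add: card_Diff_subset)
  qed
  have 2: "real (card {W \<in> subspaces_over k U. v \<in> W}) = num_over k (Suc j)" if v: "v \<in> carrier V - U" for v
  proof -
    have "real (card (subspaces_over k (adjoin U v))) = num_over k (Suc j)"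
      using Suc.hyps(2) v Suc.prems jk
      by (intro Suc.hyps(1) subspace_adjoin) (auto simp: card_adjoin card_K)
    thus ?thesis using subspaces_over_adjoin[OF Suc.prems(1), of v] v by simp
  qed
  have Qjk: "Q ^ j < Q ^ k" using jk Q_gt_1 by simp
  have "real (card (subspaces_over k U)) * (real Q ^ k - real Q ^ j) = (\<Sum>W\<in>subspaces_over k U. real (card {v \<in> carrier V - U. v \<in> W}))"
    using 1 Qjk by (simp add: of_nat_diff)
  also have "\<dots> = (\<Sum>v\<in>carrier V - U. real (card {W \<in> subspaces_over k U. v \<in> W}))"
    by (rule real_sum_card_swap) (use finite_V finite_subspaces_over in auto)
  also have "\<dots> = (real Q ^ N - real Q ^ j) * num_over k (Suc j)"
  proof -
    have "Q ^ j \<le> Q ^ N" using card_mono[OF finite_V U(1)] Suc.prems card_V by simp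
    hence "real (card (carrier V - U)) = real Q ^ N - real Q ^ j"
      using U Suc.prems card_V by (simp add: card_Diff_subset of_nat_diff)
    thus ?thesis using 2 by simp
  qed
  finally have "real (card (subspaces_over k U)) = (real Q ^ N - real Q ^ j) / (real Q ^ k - real Q ^ j) * num_over k (Suc j)"
    using Qjk by (simp add: field_simps flip: of_nat_power)
  also have "\<dots> = num_over k j"
    using jk by (simp add: num_over_def prod.atLeast_Suc_lessThan)
  finally show ?case .
qed

lemma subspace_zero: "VectorSpace.subspace K {\<zero>\<^bsub>V\<^esub>} V"
  by (rule subspaceI) auto

lemma num_over_pos: "k \<le> N \<Longrightarrow> j \<le> k \<Longrightarrow> num_over k j > 0"
  unfolding num_over_def using Q_gt_1 by (intro prod_pos) auto

text \<open>The probability that a uniformly random \<open>k\<close>-dimensional subspace contains a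
  given nonzero vector, for \<open>1 \<le> k \<le> N\<close>; \<open>num_over_0\<close> expresses
  this.\<close>

definition incl_prob :: "nat \<Rightarrow> real" where
  "incl_prob k = (real Q ^ k - 1) / (real Q ^ N - 1)"

lemma num_over_0: "1 \<le> k \<Longrightarrow> k \<le> N \<Longrightarrow> num_over k 1 = incl_prob k * num_over k 0"
proof -
  assume k: "1 \<le> k" "k \<le> N"
  have "num_over k 0 = (real Q ^ N - 1) / (real Q ^ k - 1) * num_over k 1"
    using k by (simp add: num_over_def prod.atLeast_Suc_lessThan)
  moreover have "real Q ^ k > 1" "real Q ^ N > 1" using k Q_gt_1 by (auto intro: one_less_power)
  ultimately show ?thesis by (simp add: incl_prob_def)
qed

text \<open>Given that one vector is contained, an independent second one is contained with
  probability (Q^k - Q)/(Q^N - Q). That this is at most \<open>incl_prob k\<close> amounts to (Q^N -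
  Q^k)(Q - 1) being nonnegative.\<close>

lemma num_over_1:
  assumes k: "2 \<le> k" "k \<le> N"
  shows "num_over k 2 \<le> incl_prob k * num_over k 1"
proof -
  have "num_over k 1 = (real Q ^ N - Q) / (real Q ^ k - Q) * num_over k 2"
    using k by (simp add: num_over_def prod.atLeast_Suc_lessThan numeral_2_eq_2)
  moreover have Qk: "real Q ^ k > Q" "real Q ^ N > Q"
    using k Q_gt_1 power_strict_increasing[of 1 k "real Q"] power_strict_increasing[of 1 N "real Q"] by auto
  ultimately have "num_over k 2 = (real Q ^ k - Q) / (real Q ^ N - Q) * num_over k 1"
    by simp
  moreover have "(real Q ^ k - Q) / (real Q ^ N - Q) \<le> incl_prob k"
  proof -
    have "real Q ^ k \<le> real Q ^ N" using k Q_gt_1 by (intro power_increasing) auto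
    hence "0 \<le> (real Q ^ N - real Q ^ k) * (real Q - 1)" using Q_gt_1 by simp
    moreover have "real Q ^ N > 1" using Qk(2) Q_gt_1 by linarith
    ultimately show ?thesis unfolding incl_prob_def using Qk
      by (simp add: divide_simps) (simp add: algebra_simps)
  qed
  moreover have "num_over k 1 \<ge> 0" using num_over_pos[of k 1] k by simp
  ultimately show ?thesis using mult_right_mono by fastforce
qed

lemma card_subspaces_over_zero: "real (card (subspaces_over k {\<zero>\<^bsub>V\<^esub>})) = num_over k 0"
  by (rule card_subspaces_over[OF subspace_zero]) auto

lemma card_subspaces_over_vector:
  assumes "v \<in> carrier V" "v \<noteq> \<zero>\<^bsub>V\<^esub>" "1 \<le> k"
  shows "real (card {W \<in> subspaces_over k {\<zero>\<^bsub>V\<^esub>}. v \<in> W}) = num_over k 1"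
  using card_subspaces_over[OF subspace_adjoin[OF subspace_zero assms(1)], of 1 k] assms
  by (simp add: subspaces_over_adjoin[OF subspace_zero] card_adjoin[OF subspace_zero] card_K)

text \<open>A subspace that meets \<open>B\<close> contains, along with one vector of
  \<open>B\<close>, all its \<open>Q - 1\<close> nonzero multiples, which lie in \<open>B\<close>
  too. Counting incidences between \<open>B\<close> and the subspaces thus gains the factor
  \<open>Q - 1\<close> over a plain union bound.\<close>

lemma first_moment_bound:
  assumes k: "1 \<le> k" "k \<le> N" and B: "B \<subseteq> carrier V - {\<zero>\<^bsub>V\<^esub>}"
    and scale: "\<And>c v. c \<in> carrier K - {\<zero>} \<Longrightarrow> v \<in> B \<Longrightarrow> c \<odot>\<^bsub>V\<^esub> v \<in> B"
  shows "real (card {W \<in> subspaces_over k {\<zero>\<^bsub>V\<^esub>}. B \<inter> W \<noteq> {}}) * (real Q - 1)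
    \<le> real (card B) * incl_prob k * real (card (subspaces_over k {\<zero>\<^bsub>V\<^esub>}))"
proof -
  let ?S = "subspaces_over k {\<zero>\<^bsub>V\<^esub>}"
  have finB: "finite B" using B finite_V finite_subset by blast
  have "Q - 1 \<le> card {v \<in> B. v \<in> W}" if W: "W \<in> ?S" and vB: "v \<in> B" and vW: "v \<in> W" for v W
  proof -
    have WD: "VectorSpace.subspace K W V" using W by (simp add: subspaces_over_def)
    have v: "v \<in> carrier V" "v \<noteq> \<zero>\<^bsub>V\<^esub>" using B vB by auto
    have "inj_on (\<lambda>c. c \<odot>\<^bsub>V\<^esub> v) (carrier K - {\<zero>})"
    proof (rule inj_onI)
      fix c d assume cd: "c \<in> carrier K - {\<zero>}" "d \<in> carrier K - {\<zero>}" "c \<odot>\<^bsub>V\<^esub> v = d \<odot>\<^bsub>V\<^esub> v"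
      have "(c \<ominus> d) \<odot>\<^bsub>V\<^esub> v = \<zero>\<^bsub>V\<^esub>"
        using cd v by (simp add: a_minus_def smult_l_distr smult_l_minus M.r_neg)
      hence "c \<ominus> d = \<zero>" using mult_inverse[of "c \<ominus> d" v "\<zero>\<^bsub>V\<^esub>"] v cd by fastforce
      thus "c = d" using cd by simp
    qed
    moreover have "(\<lambda>c. c \<odot>\<^bsub>V\<^esub> v) ` (carrier K - {\<zero>}) \<subseteq> {v \<in> B. v \<in> W}"
      using scale vB subspaceD(4)[OF WD] vW by auto
    ultimately have "card (carrier K - {\<zero>}) \<le> card {v \<in> B. v \<in> W}"
      using finB by (intro card_inj_on_le[where f = "\<lambda>c. c \<odot>\<^bsub>V\<^esub> v"]) auto
    thus ?thesis using card_K by simp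
  qed
  hence 1: "real Q - 1 \<le> real (card {v \<in> B. v \<in> W})" if "W \<in> {W \<in> ?S. B \<inter> W \<noteq> {}}" for W
    using that Q_gt_1 by (fastforce simp: of_nat_diff le_diff_conv simp flip: of_nat_add)
  have "real (card {W \<in> ?S. B \<inter> W \<noteq> {}}) * (real Q - 1)
      \<le> (\<Sum>W\<in>{W \<in> ?S. B \<inter> W \<noteq> {}}. real (card {v \<in> B. v \<in> W}))"
    using sum_mono[OF 1, of "{W \<in> ?S. B \<inter> W \<noteq> {}}" "\<lambda>x. x"] by simp
  also have "\<dots> \<le> (\<Sum>W\<in>?S. real (card {v \<in> B. v \<in> W}))"
    by (rule sum_mono2) (use finite_subspaces_over in auto)
  also have "\<dots> = (\<Sum>v\<in>B. real (card {W \<in> ?S. v \<in> W}))"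
    by (rule real_sum_card_swap[OF finite_subspaces_over finB])
  also have "\<dots> = (\<Sum>v\<in>B. num_over k 1)"
    by (rule sum.cong) (use card_subspaces_over_vector B k in auto)
  also have "\<dots> = real (card B) * incl_prob k * real (card ?S)"
    using num_over_0[OF k] card_subspaces_over_zero by simp
  finally show ?thesis .
qed

text \<open>Chebyshev's inequality for the number \<open>X W\<close> of vectors of \<open>B\<close>
  in \<open>W\<close>, whose mean is \<open>\<mu>\<close>. Independent vectors are not positively
  correlated, so only proportional pairs contribute to the bound on the variance, which is
  \<open>(Q - 1) * \<mu>\<close>.\<close>

lemma second_moment_bound:
  assumes k: "2 \<le> k" "k \<le> N" and B: "B \<subseteq> carrier V - {\<zero>\<^bsub>V\<^esub>}"
  shows "real (card {W \<in> subspaces_over k {\<zero>\<^bsub>V\<^esub>}. B \<inter> W = {}}) * (real (card B) * incl_prob k)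
    \<le> (real Q - 1) * real (card (subspaces_over k {\<zero>\<^bsub>V\<^esub>}))"
proof -
  let ?S = "subspaces_over k {\<zero>\<^bsub>V\<^esub>}"
  let ?b = "real (card B)" and ?p = "incl_prob k" and ?G = "real (card (subspaces_over k {\<zero>\<^bsub>V\<^esub>}))"
  define X where "X = (\<lambda>W. real (card {v \<in> B. v \<in> W}))"
  define \<mu> where "\<mu> = ?b * ?p"
  have finB: "finite B" using B finite_V finite_subset by blast
  have k1: "1 \<le> k" using k by simp
  have p0: "?p > 0" unfolding incl_prob_def using k Q_gt_1 by (auto intro!: divide_pos_pos one_less_power)
  have G1: "num_over k 1 = ?p * ?G" using num_over_0 k card_subspaces_over_zero by simp
  have G2: "num_over k 2 \<le> ?p * ?p * ?G" 
    using num_over_1[OF k] unfolding G1 by (simp add: mult.assoc)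
  have EX: "(\<Sum>W\<in>?S. X W) = \<mu> * ?G"
  proof -
    have "(\<Sum>W\<in>?S. X W) = (\<Sum>v\<in>B. real (card {W \<in> ?S. v \<in> W}))"
      unfolding X_def by (rule real_sum_card_swap[OF finite_subspaces_over finB])
    also have "\<dots> = (\<Sum>v\<in>B. num_over k 1)"
      by (rule sum.cong) (use card_subspaces_over_vector[OF _ _ k1] B in auto)
    finally show ?thesis using G1 by (simp add: \<mu>_def)
  qed
  \<comment> \<open>Split by whether \<open>v\<close> lies on the line \<open>?L\<close> through
    \<open>u\<close>. At most \<open>Q - 1\<close> vectors of \<open>B\<close> do, and for them the
    condition on \<open>v\<close> is dropped; the others span a plane with \<open>u\<close>.\<close>
  have pair: "(\<Sum>v\<in>B. real (card {W \<in> ?S. u \<in> W \<and> v \<in> W})) \<le> (real Q - 1) * ?p * ?G + ?b * ?p * ?p * ?G"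
    if u: "u \<in> B" for u
  proof -
    let ?L = "adjoin {\<zero>\<^bsub>V\<^esub>} u"
    have uV: "u \<in> carrier V" "u \<noteq> \<zero>\<^bsub>V\<^esub>" using B u by auto
    have L: "VectorSpace.subspace K ?L V" using subspace_adjoin[OF subspace_zero uV(1)] .
    have cardL: "card ?L = Q" using card_adjoin[OF subspace_zero uV(1)] uV card_K by simp
    have over_L: "subspaces_over k ?L = {W \<in> ?S. u \<in> W}" using subspaces_over_adjoin[OF subspace_zero uV(1)] .
    have cardBL: "real (card (B \<inter> ?L)) \<le> real Q - 1"
    proof -
      have "B \<inter> ?L \<subseteq> ?L - {\<zero>\<^bsub>V\<^esub>}" using B by auto
      hence "card (B \<inter> ?L) \<le> card (?L - {\<zero>\<^bsub>V\<^esub>})"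
        using finite_subspace[OF L] by (intro card_mono) auto
      also have "\<dots> = Q - 1" using cardL subspaceD(2)[OF L] by simp
      finally show ?thesis using Q_gt_1 by simp
    qed
    have in_L: "real (card {W \<in> ?S. u \<in> W \<and> v \<in> W}) \<le> ?p * ?G" for v
    proof -
      have "card {W \<in> ?S. u \<in> W \<and> v \<in> W} \<le> card {W \<in> ?S. u \<in> W}"
        using finite_subspaces_over by (intro card_mono) auto
      thus ?thesis using card_subspaces_over_vector[OF uV, of k] k G1 by simp
    qed
    have out_L: "real (card {W \<in> ?S. u \<in> W \<and> v \<in> W}) \<le> ?p * ?p * ?G" if v: "v \<in> B - ?L" for v
    proof -
      have vV: "v \<in> carrier V" "v \<notin> ?L" using v B by auto
      have "{W \<in> ?S. u \<in> W \<and> v \<in> W} = subspaces_over k (adjoin ?L v)"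
        using subspaces_over_adjoin[OF L vV(1), of k] over_L by auto
      moreover have "real (card (subspaces_over k (adjoin ?L v))) = num_over k 2"
        using vV k cardL
        by (intro card_subspaces_over subspace_adjoin L) (simp_all add: card_adjoin[OF L] card_K power2_eq_square)
      ultimately show ?thesis using G2 by simp
    qed
    have "(\<Sum>v\<in>B. real (card {W \<in> ?S. u \<in> W \<and> v \<in> W}))
        = (\<Sum>v\<in>B \<inter> ?L. real (card {W \<in> ?S. u \<in> W \<and> v \<in> W})) + (\<Sum>v\<in>B - ?L. real (card {W \<in> ?S. u \<in> W \<and> v \<in> W}))"
      using finB by (rule sum.Int_Diff)
    also have "\<dots> \<le> (\<Sum>v\<in>B \<inter> ?L. ?p * ?G) + (\<Sum>v\<in>B - ?L. ?p * ?p * ?G)"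
      by (intro add_mono sum_mono in_L out_L)
    also have "\<dots> \<le> (real Q - 1) * (?p * ?G) + ?b * (?p * ?p * ?G)"
      using cardBL p0 finB
      by (simp only: sum_constant, intro add_mono mult_right_mono) (auto intro: card_mono)
    finally show ?thesis by (simp add: mult.assoc)
  qed
  have EX2: "(\<Sum>W\<in>?S. (X W)\<^sup>2) \<le> ?b * ((real Q - 1) * ?p * ?G + ?b * ?p * ?p * ?G)"
  proof -
    have "(X W)\<^sup>2 = real (card {uv \<in> B \<times> B. fst uv \<in> W \<and> snd uv \<in> W})" for W
    proof -
      have "{uv \<in> B \<times> B. fst uv \<in> W \<and> snd uv \<in> W} = {v \<in> B. v \<in> W} \<times> {v \<in> B. v \<in> W}" by auto
      thus ?thesis by (simp add: X_def power2_eq_square card_cartesian_product)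
    qed
    hence "(\<Sum>W\<in>?S. (X W)\<^sup>2) = (\<Sum>uv\<in>B \<times> B. real (card {W \<in> ?S. fst uv \<in> W \<and> snd uv \<in> W}))"
      using real_sum_card_swap[OF finite_subspaces_over, of "B \<times> B"] finB by simp
    also have "\<dots> = (\<Sum>u\<in>B. \<Sum>v\<in>B. real (card {W \<in> ?S. u \<in> W \<and> v \<in> W}))"
      by (simp add: sum.cartesian_product case_prod_beta)
    also have "\<dots> \<le> (\<Sum>u\<in>B. (real Q - 1) * ?p * ?G + ?b * ?p * ?p * ?G)"
      by (intro sum_mono pair)
    finally show ?thesis by simp
  qed
  let ?Z = "{W \<in> ?S. B \<inter> W = {}}"
  have "real (card ?Z) * \<mu>\<^sup>2 = (\<Sum>W\<in>?Z. (X W - \<mu>)\<^sup>2)"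
  proof -
    have "(X W - \<mu>)\<^sup>2 = \<mu>\<^sup>2" if "W \<in> ?Z" for W
    proof -
      have "{v \<in> B. v \<in> W} = {}" using that by auto
      hence "X W = 0" unfolding X_def by (simp only: card.empty of_nat_0)
      thus ?thesis by simp
    qed
    thus ?thesis by simp
  qed
  also have "\<dots> \<le> (\<Sum>W\<in>?S. (X W - \<mu>)\<^sup>2)"
    by (rule sum_mono2) (use finite_subspaces_over in auto)
  \<comment> \<open>After inserting the two moments, the multiples of
    \<open>\<mu>\<^sup>2 * ?G\<close> cancel and only the contribution of proportional pairs
    remains.\<close>
  also have "\<dots> = (\<Sum>W\<in>?S. (X W)\<^sup>2) - 2 * \<mu> * (\<Sum>W\<in>?S. X W) + \<mu>\<^sup>2 * ?G"
    by (simp add: power2_diff sum.distrib sum_subtractf sum_distrib_left algebra_simps)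
  also have "\<dots> \<le> \<mu> * ((real Q - 1) * ?G)"
    using EX2 unfolding EX by (simp add: \<mu>_def power2_eq_square algebra_simps)
  finally have *: "\<mu> * (real (card ?Z) * \<mu>) \<le> \<mu> * ((real Q - 1) * ?G)"
    by (simp add: power2_eq_square ac_simps)
  show ?thesis
  proof (cases "card B = 0")
    case True
    thus ?thesis using Q_gt_1 by simp
  next
    case False
    hence "\<mu> > 0" using p0 by (simp add: \<mu>_def)
    thus ?thesis using mult_left_le_imp_le[OF *] by (simp add: \<mu>_def)
  qed
qed

end

section \<open>Hermitian matrices\<close>

lemma (in ring) func_space_sel [simp]:
  "carrier (func_space S) = S \<rightarrow>\<^sub>E carrier R"
  "f \<oplus>\<^bsub>func_space S\<^esub> g = (\<lambda>v\<in>S. f v \<oplus> g v)"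
  "c \<odot>\<^bsub>func_space S\<^esub> f = (\<lambda>v\<in>S. c \<otimes> f v)"
  "\<zero>\<^bsub>func_space S\<^esub> = (\<lambda>v\<in>S. \<zero>)"
  by (simp_all add: func_space_def)

lemma (in field) func_space_vectorspace: "vectorspace R (func_space S)"
  using func_space_is_module field_axioms by (simp add: vectorspace_def)

text \<open>Used to read off single entries from a linear combination of matrix columns.\<close>

lemma (in cring) finsum_func_space_apply:
  assumes "finite A" "f \<in> A \<rightarrow> (S \<rightarrow>\<^sub>E carrier R)" "t \<in> S"
  shows "finsum (func_space S) f A t = (\<Oplus>i\<in>A. f i t)"
proof -
  interpret F: Module.module R "func_space S" by (rule func_space_is_module)
  show ?thesis using assms
  proof (induction A rule: finite_induct)
    case (insert a A)
    have "finsum (func_space S) f (insert a A) = f a \<oplus>\<^bsub>func_space S\<^esub> finsum (func_space S) f A"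
      using insert by (intro F.finsum_insert) auto
    hence "finsum (func_space S) f (insert a A) t = f a t \<oplus> finsum (func_space S) f A t"
      using insert.prems by simp
    also have "\<dots> = (\<Oplus>i\<in>insert a A. f i t)"
      using insert by (subst finsum_insert) (auto simp: Pi_iff PiE_iff)
    finally show ?case .
  qed simp
qed

context hermitian_field
begin

lemma Her_iff:
  "M \<in> carrier (Her K q n) \<longleftrightarrow>
     M \<in> {..<n} \<times> {..<n} \<rightarrow>\<^sub>E carrier K \<and> (\<forall>i<n. \<forall>j<n. bar (M (j, i)) = M (i, j))"
proof -
  have ct: "conj_transpose K q n M (i, j) = (if i < n \<and> j < n then bar (M (j, i)) else undefined)" for i j
    by (simp add: conj_transpose_def)
  have "M = conj_transpose K q n M \<longleftrightarrow> (\<forall>i<n. \<forall>j<n. bar (M (j, i)) = M (i, j))"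
    if "M \<in> {..<n} \<times> {..<n} \<rightarrow>\<^sub>E carrier K"
  proof
    assume "M = conj_transpose K q n M"
    hence "M (i, j) = conj_transpose K q n M (i, j)" for i j by (rule fun_cong)
    thus "\<forall>i<n. \<forall>j<n. bar (M (j, i)) = M (i, j)" unfolding ct by metis
  next
    assume *: "\<forall>i<n. \<forall>j<n. bar (M (j, i)) = M (i, j)"
    \<comment> \<open>Outside the index square both sides are \<open>undefined\<close>.\<close>
    have "M (i, j) = conj_transpose K q n M (i, j)" for i j
      using * PiE_arb[OF that, of "(i, j)"] unfolding ct by auto
    thus "M = conj_transpose K q n M" by (auto simp: fun_eq_iff)
  qed
  moreover have "M \<in> carrier (Her K q n) \<longleftrightarrow>
      M \<in> {..<n} \<times> {..<n} \<rightarrow>\<^sub>E carrier K \<and> M = conj_transpose K q n M"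
    unfolding Her_def func_space_sel(1) by simp
  ultimately show ?thesis by blast
qed

lemma Her_sel [simp]:
  "f \<oplus>\<^bsub>Her K q n\<^esub> g = (\<lambda>v\<in>{..<n} \<times> {..<n}. f v \<oplus> g v)"
  "c \<odot>\<^bsub>Her K q n\<^esub> f = (\<lambda>v\<in>{..<n} \<times> {..<n}. c \<otimes> f v)"
  "\<zero>\<^bsub>Her K q n\<^esub> = (\<lambda>v\<in>{..<n} \<times> {..<n}. \<zero>)"
  by (simp_all add: Her_def)

lemma base_field_sel [simp]:
  "carrier (base_field K q) = Fq" "x \<otimes>\<^bsub>base_field K q\<^esub> y = x \<otimes> y"
  "x \<oplus>\<^bsub>base_field K q\<^esub> y = x \<oplus> y" "\<one>\<^bsub>base_field K q\<^esub> = \<one>" "\<zero>\<^bsub>base_field K q\<^esub> = \<zero>"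
  by (simp_all add: base_field_def)

lemma Her_subset: "carrier (Her K q n) \<subseteq> {..<n} \<times> {..<n} \<rightarrow>\<^sub>E carrier K"
  unfolding Her_iff subset_iff by blast

lemma Her_entry: "M \<in> carrier (Her K q n) \<Longrightarrow> i < n \<Longrightarrow> j < n \<Longrightarrow> M (i, j) \<in> carrier K"
  by (auto simp: Her_iff)

lemma Her_sym: "M \<in> carrier (Her K q n) \<Longrightarrow> i < n \<Longrightarrow> j < n \<Longrightarrow> bar (M (j, i)) = M (i, j)"
  unfolding Her_iff by blast

lemma Her_eqI:
  assumes "M \<in> carrier (Her K q n)" "M' \<in> carrier (Her K q n)"
    and "\<And>i j. i < n \<Longrightarrow> j < n \<Longrightarrow> M (i, j) = M' (i, j)"
  shows "M = M'"
  using assms by (intro PiE_ext[of M "{..<n} \<times> {..<n}" "\<lambda>_. carrier K" M']) (auto simp: Her_iff)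

lemma finite_Her: "finite (carrier (Her K q n))"
  by (rule finite_subset[OF Her_subset]) (auto simp: finite_K intro!: finite_PiE)

text \<open>Restriction of scalars: the identities are inherited from the matrix space over
  \<open>K\<close>, and only closure has to be checked.\<close>

lemma vectorspace_Her: "vectorspace (base_field K q) (Her K q n)"
proof -
  interpret M: vectorspace K "mat_module K n" by (rule func_space_vectorspace)
  let ?H = "Her K q n" and ?M = "mat_module K n"
  have H: "carrier ?H \<subseteq> carrier ?M" using Her_subset by simp
  \<comment> \<open>The operations are rewritten to those of the matrix space and kept folded, so
    that its module laws apply directly.\<close>
  have [simp]: "f \<oplus>\<^bsub>?H\<^esub> g = f \<oplus>\<^bsub>?M\<^esub> g" "c \<odot>\<^bsub>?H\<^esub> f = c \<odot>\<^bsub>?M\<^esub> f" "\<zero>\<^bsub>?H\<^esub> = \<zero>\<^bsub>?M\<^esub>" for f g c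
    by (simp_all add: Her_def)
  note [simp del] = func_space_sel Her_sel
  \<comment> \<open>This is where the scalars must be fixed by conjugation.\<close>
  have sc: "c \<odot>\<^bsub>?M\<^esub> v \<in> carrier ?H" if "c \<in> Fq" "v \<in> carrier ?H" for c v
  proof -
    have "bar (c \<otimes> v (j, i)) = c \<otimes> v (i, j)" if "i < n" "j < n" for i j
      using \<open>c \<in> Fq\<close> \<open>v \<in> carrier ?H\<close> that Her_sym[of v n i j] Her_entry[of v n j i]
      by (simp add: nat_pow_distrib)
    thus ?thesis using that by (auto simp: Her_iff func_space_sel)
  qed
  show ?thesis
  proof (rule vs_criteria[OF field_base_field])
    show "\<zero>\<^bsub>?H\<^esub> \<in> carrier ?H" using q_gt_1 by (auto simp: Her_iff func_space_sel)
    show "\<forall>v w. v \<in> carrier ?H \<and> w \<in> carrier ?H \<longrightarrow> v \<oplus>\<^bsub>?H\<^esub> w \<in> carrier ?H"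
    proof clarify
      fix v w assume vw: "v \<in> carrier ?H" "w \<in> carrier ?H"
      have "bar (v (j, i) \<oplus> w (j, i)) = v (i, j) \<oplus> w (i, j)" if "i < n" "j < n" for i j
        using vw that Her_sym[of v n i j] Her_sym[of w n i j] Her_entry[of v n j i] Her_entry[of w n j i]
        by (simp add: bar_add)
      thus "v \<oplus>\<^bsub>?H\<^esub> w \<in> carrier ?H" using vw by (auto simp: Her_iff func_space_sel)
    qed
    show "\<forall>v\<in>carrier ?H. \<exists>w\<in>carrier ?H. v \<oplus>\<^bsub>?H\<^esub> w = \<zero>\<^bsub>?H\<^esub>"
    proof
      fix v assume v: "v \<in> carrier ?H"
      have "\<ominus> \<one> \<in> Fq" using subringE(3,5)[OF subfieldE(1)[OF subfield_Fq]] by blast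
      hence "(\<ominus> \<one>) \<odot>\<^bsub>?M\<^esub> v \<in> carrier ?H" using sc v by blast
      moreover have "v \<oplus>\<^bsub>?H\<^esub> ((\<ominus> \<one>) \<odot>\<^bsub>?M\<^esub> v) = \<zero>\<^bsub>?H\<^esub>"
        using v H M.smult_minus_1[of v] M.M.r_neg[of v] by auto
      ultimately show "\<exists>w\<in>carrier ?H. v \<oplus>\<^bsub>?H\<^esub> w = \<zero>\<^bsub>?H\<^esub>" by blast
    qed
  qed (use H sc in \<open>auto simp: subset_iff M.M.a_ac M.smult_assoc1 M.smult_l_distr M.smult_r_distr\<close>)
qed

text \<open>For \<open>I = {..<n}\<close> these are the entries on and above the diagonal; in general they determine
  the columns of a Hermitian matrix with index in \<open>I\<close>.\<close>

definition free_entries :: "nat \<Rightarrow> nat set \<Rightarrow> (nat \<times> nat) set" where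
  "free_entries n I = {(i, j). i < n \<and> j \<in> I \<and> (i \<in> I \<longrightarrow> i \<le> j)}"

text \<open>Hermitian symmetry forces diagonal entries to be fixed by \<open>bar\<close>, and it
  does not restrict a single entry off the diagonal.\<close>

definition entry_range :: "nat \<times> nat \<Rightarrow> 'a set" where
  "entry_range = (\<lambda>(i, j). if i = j then Fq else carrier K)"

text \<open>With r the size of \<open>I\<close>, there are r diagonal positions with
  \<open>q\<close> choices each, and r(r-1)/2 + (n-r)r others with \<open>q\<^sup>2\<close> choices
  each. The exponent is r + r(r-1) + 2(n-r)r = r(2n-r).\<close>

lemma card_free_entries_PiE:
  assumes I: "I \<subseteq> {..<n}"
  shows "card (PiE (free_entries n I) entry_range) = q ^ (card I * (2 * n - card I))"
proof -
  let ?P = "{(i, j) \<in> I \<times> I. i < j}" and ?P' = "{(i, j) \<in> I \<times> I. j < i}" and ?R = "({..<n} - I) \<times> I"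
  let ?D = "(\<lambda>i. (i, i)) ` I"
  define r where "r = card I"
  have finI: "finite I" using I finite_subset by blast
  have finP: "finite ?P" "finite ?P'" using finI by (auto intro: finite_subset[of _ "I \<times> I"])
  have rn: "r \<le> n" using card_mono[OF _ I] by (simp add: r_def)
  have "bij_betw prod.swap ?P ?P'" by (rule bij_betwI[of _ _ _ prod.swap]) auto
  hence P': "card ?P' = card ?P" by (simp add: bij_betw_same_card)
  have D: "card ?D = r" unfolding r_def by (rule card_image) (auto simp: inj_on_def)
  have "I \<times> I = (?P \<union> ?P') \<union> ?D" by auto
  hence "card (I \<times> I) = card ((?P \<union> ?P') \<union> ?D)" by (rule arg_cong)
  also have "\<dots> = card (?P \<union> ?P') + card ?D"
    using finP finI by (intro card_Un_disjoint) auto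
  also have "card (?P \<union> ?P') = card ?P + card ?P'"
    using finP by (intro card_Un_disjoint) auto
  finally have PP: "r * r = 2 * card ?P + r"
    using P' D by (simp add: card_cartesian_product r_def)
  have cR: "card ?R = (n - r) * r"
    using I finI by (simp add: card_cartesian_product card_Diff_subset r_def)
  have off: "card (?P \<union> ?R) = card ?P + (n - r) * r"
    using finP finI cR by (subst card_Un_disjoint) auto
  have E: "free_entries n I = ?D \<union> (?P \<union> ?R)"
    using I by (auto simp: free_entries_def)
  have "card (PiE (free_entries n I) entry_range) = (\<Prod>x\<in>free_entries n I. card (entry_range x))"
    using finP finI by (intro card_PiE) (simp add: E)
  also have "\<dots> = (\<Prod>x\<in>?D. card (entry_range x)) * (\<Prod>x\<in>?P \<union> ?R. card (entry_range x))"
    unfolding E using finP finI by (intro prod.union_disjoint) auto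
  also have "(\<Prod>x\<in>?D. card (entry_range x)) = (\<Prod>x\<in>?D. q)"
    by (rule prod.cong) (auto simp: entry_range_def card_Fq)
  also have "(\<Prod>x\<in>?P \<union> ?R. card (entry_range x)) = (\<Prod>x\<in>?P \<union> ?R. q\<^sup>2)"
    by (rule prod.cong) (auto simp: entry_range_def card_K)
  also have "(\<Prod>x\<in>?D. q) * (\<Prod>x\<in>?P \<union> ?R. q\<^sup>2) = q ^ (r + 2 * (card ?P + (n - r) * r))"
    by (simp only: prod_constant D off power_mult[symmetric] power_add[symmetric])
  also have "r + 2 * (card ?P + (n - r) * r) = r * (2 * n - r)"
  proof -
    \<comment> \<open>Substituting for \<open>n\<close> removes the truncated subtractions.\<close>
    obtain s where s: "n = r + s" using rn le_Suc_ex by blast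
    show ?thesis using PP unfolding s by (simp add: algebra_simps)
  qed
  finally show ?thesis by (simp add: r_def)
qed

lemma restrict_Her_in_PiE:
  assumes "M \<in> carrier (Her K q n)" "I \<subseteq> {..<n}"
  shows "restrict M (free_entries n I) \<in> PiE (free_entries n I) entry_range"
proof (rule restrict_PiE_iff[THEN iffD2], clarify)
  fix i j assume "(i, j) \<in> free_entries n I"
  hence ij: "i < n" "j < n" using assms(2) by (auto simp: free_entries_def)
  show "M (i, j) \<in> entry_range (i, j)"
    using Her_entry[OF assms(1) ij] Her_sym[OF assms(1) ij] by (auto simp: entry_range_def)
qed

text \<open>If a position in a column of \<open>I\<close> is not free, then its row index lies in
  \<open>I\<close> as well and the transposed position is free.\<close>

lemma Her_columns_determined:
  assumes M: "M \<in> carrier (Her K q n)" and M': "M' \<in> carrier (Her K q n)" and I: "I \<subseteq> {..<n}"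
    and eq: "restrict M (free_entries n I) = restrict M' (free_entries n I)"
    and ij: "i < n" "j \<in> I"
  shows "M (i, j) = M' (i, j)"
proof -
  have e: "M x = M' x" if "x \<in> free_entries n I" for x
    using fun_cong[OF eq, of x] that by simp
  show ?thesis
  proof (cases "(i, j) \<in> free_entries n I")
    case False
    hence "(j, i) \<in> free_entries n I" using ij I by (auto simp: free_entries_def)
    thus ?thesis using e[of "(j, i)"] Her_sym[OF M, of i j] Her_sym[OF M', of i j] ij I by auto
  qed (use e in blast)
qed

text \<open>A Hermitian matrix amounts to a free choice of its entries on and above the diagonal;
  the inverse map \<open>?g\<close> fills in conjugates below.\<close>

lemma card_Her: "card (carrier (Her K q n)) = q ^ n\<^sup>2"
proof -
  let ?E = "free_entries n {..<n}"
  let ?f = "\<lambda>M. restrict M ?E"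
  let ?g = "\<lambda>f. \<lambda>(i, j)\<in>{..<n} \<times> {..<n}. if i \<le> j then f (i, j) else bar (f (j, i))"
  have fE: "f (i, j) \<in> carrier K" if "f \<in> PiE ?E entry_range" "i \<le> j" "j < n" for f i j
    using PiE_mem[OF that(1), of "(i, j)"] that(2,3)
    by (auto simp: free_entries_def entry_range_def split: if_splits)
  have fD: "bar (f (i, i)) = f (i, i)" if "f \<in> PiE ?E entry_range" "i < n" for f i
    using PiE_mem[OF that(1), of "(i, i)"] that(2)
    by (auto simp: free_entries_def entry_range_def)
  have g: "?g f \<in> carrier (Her K q n)" if f: "f \<in> PiE ?E entry_range" for f
    unfolding Her_iff
  proof
    show "?g f \<in> {..<n} \<times> {..<n} \<rightarrow>\<^sub>E carrier K" using fE[OF f] by auto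
    show "\<forall>i<n. \<forall>j<n. bar (?g f (j, i)) = ?g f (i, j)"
    proof (intro allI impI)
      fix i j assume ij: "i < n" "j < n"
      consider "i = j" | "i < j" | "j < i" by linarith
      thus "bar (?g f (j, i)) = ?g f (i, j)"
        using ij fD[OF f, of i] bar_bar[OF fE[OF f, of i j]] by cases simp_all
    qed
  qed
  have "bij_betw ?f (carrier (Her K q n)) (PiE ?E entry_range)"
  proof (rule bij_betw_byWitness[where f' = ?g])
    show "\<forall>M\<in>carrier (Her K q n). ?g (?f M) = M"
    proof
      fix M assume M: "M \<in> carrier (Her K q n)"
      show "?g (?f M) = M"
      proof (rule Her_eqI[OF g[OF restrict_Her_in_PiE[OF M]] M])
        fix i j assume "i < n" "j < n"
        thus "?g (?f M) (i, j) = M (i, j)"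
          using Her_sym[OF M, of i j] by (auto simp: free_entries_def)
      qed auto
    qed
    show "\<forall>f\<in>PiE ?E entry_range. ?f (?g f) = f"
    proof
      fix f assume f: "f \<in> PiE ?E entry_range"
      show "?f (?g f) = f"
      proof
        fix x show "?f (?g f) x = f x"
          using f by (cases x) (auto simp: free_entries_def PiE_def extensional_def)
      qed
    qed
    show "?f ` carrier (Her K q n) \<subseteq> PiE ?E entry_range" using restrict_Her_in_PiE by blast
    show "?g ` PiE ?E entry_range \<subseteq> carrier (Her K q n)" using g by blast
  qed
  hence "card (carrier (Her K q n)) = card (PiE ?E entry_range)" by (rule bij_betw_same_card)
  thus ?thesis using card_free_entries_PiE[of "{..<n}" n] by (simp add: power2_eq_square)
qed

end

section \<open>Hermitian matrices of low rank\<close>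

context hermitian_field
begin

lemma mat_col_in: "M \<in> {..<n} \<times> {..<n} \<rightarrow>\<^sub>E carrier K \<Longrightarrow> j < n \<Longrightarrow> mat_col n M j \<in> {..<n} \<rightarrow>\<^sub>E carrier K"
  by (auto simp: mat_col_def)

text \<open>The column span has \<open>card (carrier K) ^ mat_rank K n M\<close> elements. This form
  lets rank bounds be proved by exhibiting any small subspace that contains the columns.\<close>

lemma mat_rank_le_iff:
  assumes M: "M \<in> {..<n} \<times> {..<n} \<rightarrow>\<^sub>E carrier K"
  shows "mat_rank K n M \<le> r \<longleftrightarrow> (\<exists>U. VectorSpace.subspace K U (vec_module K n) \<and>
    card U \<le> card (carrier K) ^ r \<and> (\<forall>j<n. mat_col n M j \<in> U))"
proof -
  interpret V: vectorspace K "vec_module K n" by (rule func_space_vectorspace)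
  let ?C = "mat_col n M ` {..<n}"
  have C: "?C \<subseteq> carrier (vec_module K n)" using mat_col_in[OF M] by auto
  have finV: "finite (carrier (vec_module K n))" by (auto simp: finite_K intro!: finite_PiE)
  have S: "VectorSpace.subspace K (V.span ?C) (vec_module K n)" using V.span_is_subspace[OF C] .
  have card: "card (V.span ?C) = card (carrier K) ^ mat_rank K n M"
    unfolding mat_rank_def using V.card_subspace[OF S finV] .
  have Q1: "card (carrier K) > 1" using one_less_power[OF q_gt_1, of 2] card_K by simp
  show ?thesis
  proof
    assume "mat_rank K n M \<le> r"
    hence "card (V.span ?C) \<le> card (carrier K) ^ r"
      unfolding card using Q1 by (intro power_increasing) auto
    thus "\<exists>U. VectorSpace.subspace K U (vec_module K n) \<and>
        card U \<le> card (carrier K) ^ r \<and> (\<forall>j<n. mat_col n M j \<in> U)"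
      using S V.in_own_span[OF C] by auto
  next
    assume "\<exists>U. VectorSpace.subspace K U (vec_module K n) \<and>
        card U \<le> card (carrier K) ^ r \<and> (\<forall>j<n. mat_col n M j \<in> U)"
    then obtain U where U: "VectorSpace.subspace K U (vec_module K n)" "card U \<le> card (carrier K) ^ r"
      "\<forall>j<n. mat_col n M j \<in> U" by blast
    have "V.span ?C \<subseteq> U" using U by (intro V.span_is_subset) (auto simp: VectorSpace.subspace_def)
    moreover have "finite U" using V.subspaceD(1)[OF U(1)] finV finite_subset by blast
    ultimately have "card (V.span ?C) \<le> card (carrier K) ^ r"
      using U(2) card_mono order_trans by blast
    thus "mat_rank K n M \<le> r" unfolding card using Q1 by simp
  qed
qed

text \<open>A subspace containing the columns of \<open>M\<close> also contains their multiples.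
  This makes the set of low-rank matrices closed under scaling, as the first moment bound
  requires.\<close>

lemma mat_rank_smult:
  assumes M: "M \<in> {..<n} \<times> {..<n} \<rightarrow>\<^sub>E carrier K" and c: "c \<in> carrier K"
  shows "mat_rank K n (\<lambda>v\<in>{..<n} \<times> {..<n}. c \<otimes> M v) \<le> mat_rank K n M"
proof -
  interpret V: vectorspace K "vec_module K n" by (rule func_space_vectorspace)
  let ?cM = "\<lambda>v\<in>{..<n} \<times> {..<n}. c \<otimes> M v"
  have cM: "?cM \<in> {..<n} \<times> {..<n} \<rightarrow>\<^sub>E carrier K" using M c by auto
  obtain U where U: "VectorSpace.subspace K U (vec_module K n)"
      "card U \<le> card (carrier K) ^ mat_rank K n M" "\<forall>j<n. mat_col n M j \<in> U"
    using mat_rank_le_iff[OF M, of "mat_rank K n M"] by blast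
  have "mat_col n ?cM j \<in> U" if j: "j < n" for j
  proof -
    have "mat_col n ?cM j = c \<odot>\<^bsub>vec_module K n\<^esub> mat_col n M j"
      using j by (auto simp: mat_col_def)
    thus ?thesis using V.subspaceD(4)[OF U(1) c] U(3) j by metis
  qed
  thus ?thesis using mat_rank_le_iff[OF cM] U by blast
qed

section \<open>Upper bound for the number of Hermitian matrices of low rank\<close>

definition col_spanned :: "nat \<Rightarrow> nat set \<Rightarrow> (nat \<times> nat \<Rightarrow> 'a) \<Rightarrow> bool" where
  "col_spanned n I M \<longleftrightarrow> (\<forall>j<n. \<exists>c\<in>I \<rightarrow> carrier K. \<forall>t<n. M (t, j) = (\<Oplus>i\<in>I. M (t, i) \<otimes> c i))"

text \<open>The columns contain a basis of their span. Its indices are padded to exactly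
  \<open>r\<close> many, so that the later count depends on \<open>r\<close> alone.\<close>

lemma col_spanned_if_mat_rank_le:
  assumes M: "M \<in> {..<n} \<times> {..<n} \<rightarrow>\<^sub>E carrier K" and r: "mat_rank K n M \<le> r" and rn: "r \<le> n"
  shows "\<exists>I. I \<subseteq> {..<n} \<and> card I = r \<and> col_spanned n I M"
proof -
  interpret V: vectorspace K "vec_module K n" by (rule func_space_vectorspace)
  let ?C = "mat_col n M ` {..<n}"
  have C: "?C \<subseteq> carrier (vec_module K n)" using mat_col_in[OF M] by auto
  have S: "VectorSpace.subspace K (V.span ?C) (vec_module K n)" using V.span_is_subspace[OF C] .
  hence SM: "submodule K (V.span ?C) (vec_module K n)" by (simp add: VectorSpace.subspace_def)
  interpret W: vectorspace K "V.vs (V.span ?C)" using V.subspace_is_vs[OF S] .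
  have CS: "?C \<subseteq> V.span ?C" using V.in_own_span[OF C] .
  have "W.span ?C = V.span ?C" using V.span_li_not_depend(1)[OF CS SM] .
  hence "\<exists>b\<subseteq>?C. minimal b (\<lambda>S. S \<subseteq> carrier (V.vs (V.span ?C)) \<and> W.gen_set S)"
    using CS by (intro minimal_exists) auto
  then obtain b where b: "b \<subseteq> ?C" "W.basis b" using W.min_gen_is_basis by blast
  have finb: "finite b" using b(1) finite_subset by blast
  have "card b = mat_rank K n M"
    unfolding mat_rank_def using W.dim_basis[OF finb b(2)] by simp
  \<comment> \<open>Different indices may carry equal columns, so one index is chosen for each basis
    column.\<close>
  moreover obtain I0 where I0: "I0 \<subseteq> {..<n}" "inj_on (mat_col n M) I0" "b = mat_col n M ` I0"
    using b(1) by (metis subset_image_inj)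
  ultimately have cI0: "card I0 \<le> r" using r card_image by metis
  have "\<exists>I. I0 \<subseteq> I \<and> I \<subseteq> {..<n} \<and> card I = r"
    using exists_subset_between[OF cI0 _ I0(1)] rn by auto
  then obtain I where I: "I0 \<subseteq> I" "I \<subseteq> {..<n}" "card I = r" by blast
  have finI: "finite I" "finite I0" using I I0 finite_subset by blast+
  have entry: "M (t, i) \<in> carrier K" if "t < n" "i \<in> I" for t i
    using M that I(2) by auto
  have "col_spanned n I M"
    unfolding col_spanned_def
  proof (intro allI impI)
    fix j assume j: "j < n"
    have bV: "b \<subseteq> carrier (vec_module K n)" using b(1) C by blast
    have bS: "b \<subseteq> V.span ?C" using b(1) CS by blast
    have "W.span b = V.span b" using V.span_li_not_depend(1)[OF bS SM] .
    moreover have "W.span b = V.span ?C" using b(2) by (simp add: W.basis_def)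
    ultimately have "mat_col n M j \<in> V.span b" using CS j by auto
    then obtain a where a: "a \<in> b \<rightarrow> carrier K" "V.lincomb a b = mat_col n M j"
      using V.finite_in_span[OF finb bV] by blast
    \<comment> \<open>The padding indices get the coefficient zero.\<close>
    define c where "c = (\<lambda>i. if i \<in> I0 then a (mat_col n M i) else \<zero>)"
    have ac: "a (mat_col n M i) \<in> carrier K" if "i \<in> I0" for i using a(1) I0(3) that by auto
    have c: "c \<in> I \<rightarrow> carrier K" using ac by (auto simp: c_def)
    have "M (t, j) = (\<Oplus>i\<in>I. M (t, i) \<otimes> c i)" if t: "t < n" for t
    proof -
      define g where "g = (\<lambda>v. a v \<odot>\<^bsub>vec_module K n\<^esub> v)"
      have g: "g (mat_col n M i) \<in> {..<n} \<rightarrow>\<^sub>E carrier K" if "i \<in> I0" for i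
        using ac[OF that] mat_col_in[OF M, of i] I0(1) that by (auto simp: g_def)
      have "V.lincomb a b = finsum (vec_module K n) (\<lambda>i. g (mat_col n M i)) I0"
        unfolding V.lincomb_def I0(3) g_def[symmetric]
        using V.M.finsum_reindex[OF _ I0(2), of g] g by (auto simp: g_def[symmetric])
      hence "mat_col n M j t = finsum (vec_module K n) (\<lambda>i. g (mat_col n M i)) I0 t" using a(2) by simp
      also have "\<dots> = (\<Oplus>i\<in>I0. g (mat_col n M i) t)"
        using g t finI by (intro finsum_func_space_apply) auto
      also have "\<dots> = (\<Oplus>i\<in>I0. M (t, i) \<otimes> c i)"
        using ac entry I(1) t by (intro finsum_cong') (auto simp: c_def g_def mat_col_def m_comm)
      also have "\<dots> = (\<Oplus>i\<in>I. M (t, i) \<otimes> c i)"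
        using finI I(1) ac entry t
        by (intro add.finprod_mono_neutral_cong_left) (auto simp: c_def)
      finally show ?thesis using t by (simp add: mat_col_def)
    qed
    thus "\<exists>c\<in>I \<rightarrow> carrier K. \<forall>t<n. M (t, j) = (\<Oplus>i\<in>I. M (t, i) \<otimes> c i)" using c by blast
  qed
  thus ?thesis using I by blast
qed

text \<open>The columns of \<open>M - M'\<close> are combinations of the common columns in \<open>I\<close> and vanish in the rows in
  \<open>I\<close>, hence in all rows, as by symmetry the rows of \<open>M\<close> are combinations of those in \<open>I\<close>.\<close>

lemma Her_eq_if_col_spanned:
  assumes M: "M \<in> carrier (Her K q n)" "col_spanned n I M"
    and M': "M' \<in> carrier (Her K q n)" "col_spanned n I M'"
    and I: "I \<subseteq> {..<n}" and eq: "\<And>i j. i < n \<Longrightarrow> j \<in> I \<Longrightarrow> M (i, j) = M' (i, j)"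
  shows "M = M'"
proof (rule Her_eqI[OF M(1) M'(1)])
  fix t j assume t: "t < n" and j: "j < n"
  have finI: "finite I" using I finite_subset by blast
  have entry: "M (a, b) \<in> carrier K" if "a < n" "b < n" for a b using Her_entry[OF M(1)] that .
  have entry': "M' (a, b) \<in> carrier K" if "a < n" "b < n" for a b using Her_entry[OF M'(1)] that .
  have In: "i < n" if "i \<in> I" for i using I that by auto
  obtain c where c: "c \<in> I \<rightarrow> carrier K" "\<forall>s<n. M (s, j) = (\<Oplus>i\<in>I. M (s, i) \<otimes> c i)"
    using M(2) j unfolding col_spanned_def by blast
  obtain c' where c': "c' \<in> I \<rightarrow> carrier K" "\<forall>s<n. M' (s, j) = (\<Oplus>i\<in>I. M' (s, i) \<otimes> c' i)"
    using M'(2) j unfolding col_spanned_def by blast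
  obtain b where b: "b \<in> I \<rightarrow> carrier K" "\<forall>s<n. M (s, t) = (\<Oplus>i\<in>I. M (s, i) \<otimes> b i)"
    using M(2) t unfolding col_spanned_def by blast
  \<comment> \<open>Conjugating the relation for column \<open>t\<close> expresses row
    \<open>t\<close> through the rows in \<open>I\<close>, with coefficients that do not depend on
    \<open>i\<close>.\<close>
  have row: "M (t, i) = (\<Oplus>s\<in>I. bar (b s) \<otimes> M (s, i))" if i: "i \<in> I" for i
  proof -
    have "M (t, i) = bar (M (i, t))" using Her_sym[OF M(1) t In[OF i]] by simp
    also have "\<dots> = bar (\<Oplus>s\<in>I. M (i, s) \<otimes> b s)" using b(2) In[OF i] by simp
    also have "\<dots> = (\<Oplus>s\<in>I. bar (M (i, s) \<otimes> b s))"
      using b(1) entry In i by (subst bar.hom_finsum) (auto simp: o_def)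
    also have "\<dots> = (\<Oplus>s\<in>I. bar (b s) \<otimes> M (s, i))"
    proof (rule finsum_cong')
      fix s assume s: "s \<in> I"
      have "bar (M (i, s) \<otimes> b s) = bar (M (i, s)) \<otimes> bar (b s)"
        using b(1) entry In i s by (intro nat_pow_distrib) auto
      also have "bar (M (i, s)) = M (s, i)" using Her_sym[OF M(1)] In i s by auto
      finally show "bar (M (i, s) \<otimes> b s) = bar (b s) \<otimes> M (s, i)"
        using b(1) entry In i s by (auto simp: m_comm Pi_iff)
    qed (use b(1) entry In i in \<open>auto simp: Pi_iff\<close>)
    finally show ?thesis .
  qed
  have expand: "(\<Oplus>i\<in>I. M (t, i) \<otimes> e i) = (\<Oplus>s\<in>I. bar (b s) \<otimes> (\<Oplus>i\<in>I. M (s, i) \<otimes> e i))"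
    if e: "e \<in> I \<rightarrow> carrier K" for e
  proof -
    have "(\<Oplus>i\<in>I. M (t, i) \<otimes> e i) = (\<Oplus>i\<in>I. \<Oplus>s\<in>I. bar (b s) \<otimes> M (s, i) \<otimes> e i)"
    proof (rule finsum_cong')
      fix i assume i: "i \<in> I"
      show "M (t, i) \<otimes> e i = (\<Oplus>s\<in>I. bar (b s) \<otimes> M (s, i) \<otimes> e i)"
        unfolding row[OF i] using b(1) e entry In i finI by (intro finsum_ldistr) (auto simp: Pi_iff)
    qed (use b(1) e entry In in \<open>auto intro!: finsum_closed simp: Pi_iff\<close>)
    also have "\<dots> = (\<Oplus>s\<in>I. \<Oplus>i\<in>I. bar (b s) \<otimes> M (s, i) \<otimes> e i)"
      using b(1) e entry In finI by (intro finsum_finsum_swap) (auto simp: Pi_iff)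
    also have "\<dots> = (\<Oplus>s\<in>I. bar (b s) \<otimes> (\<Oplus>i\<in>I. M (s, i) \<otimes> e i))"
    proof (rule finsum_cong')
      fix s assume s: "s \<in> I"
      have "bar (b s) \<otimes> (\<Oplus>i\<in>I. M (s, i) \<otimes> e i) = (\<Oplus>i\<in>I. bar (b s) \<otimes> (M (s, i) \<otimes> e i))"
        using b(1) e entry In s finI by (intro finsum_rdistr) (auto simp: Pi_iff)
      also have "\<dots> = (\<Oplus>i\<in>I. bar (b s) \<otimes> M (s, i) \<otimes> e i)"
        using b(1) e entry In s by (intro finsum_cong') (auto simp: m_assoc Pi_iff)
      finally show "(\<Oplus>i\<in>I. bar (b s) \<otimes> M (s, i) \<otimes> e i) = bar (b s) \<otimes> (\<Oplus>i\<in>I. M (s, i) \<otimes> e i)" by simp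
    qed (use b(1) e entry In in \<open>auto intro!: finsum_closed simp: Pi_iff\<close>)
    finally show ?thesis .
  qed
  have "M (t, j) = (\<Oplus>s\<in>I. bar (b s) \<otimes> M (s, j))"
    using c(2) t expand[OF c(1)] b(1) entry In j by (auto intro!: finsum_cong' simp: Pi_iff)
  \<comment> \<open>The passage from \<open>M\<close> to \<open>M'\<close>: for \<open>s\<close> in
    \<open>I\<close>, the entry at \<open>(s, j)\<close> is the conjugate of an entry in the common
    column \<open>s\<close>.\<close>
  also have "\<dots> = (\<Oplus>s\<in>I. bar (b s) \<otimes> M' (s, j))"
  proof (rule finsum_cong')
    fix s assume s: "s \<in> I"
    have "M (s, j) = bar (M (j, s))" using Her_sym[OF M(1) In[OF s] j] by simp
    also have "\<dots> = bar (M' (j, s))" using eq[OF j s] by simp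
    also have "\<dots> = M' (s, j)" using Her_sym[OF M'(1) In[OF s] j] by simp
    finally show "bar (b s) \<otimes> M (s, j) = bar (b s) \<otimes> M' (s, j)" by simp
  qed (use b(1) entry' In j in \<open>auto simp: Pi_iff\<close>)
  also have "\<dots> = (\<Oplus>s\<in>I. bar (b s) \<otimes> (\<Oplus>i\<in>I. M (s, i) \<otimes> c' i))"
  proof (rule finsum_cong')
    fix s assume s: "s \<in> I"
    have "M' (s, j) = (\<Oplus>i\<in>I. M' (s, i) \<otimes> c' i)" using c'(2) In[OF s] by blast
    also have "\<dots> = (\<Oplus>i\<in>I. M (s, i) \<otimes> c' i)"
      using eq In[OF s] c'(1) entry entry' In by (intro finsum_cong') (auto simp: Pi_iff)
    finally show "bar (b s) \<otimes> M' (s, j) = bar (b s) \<otimes> (\<Oplus>i\<in>I. M (s, i) \<otimes> c' i)" by simp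
  qed (use b(1) c'(1) entry In in \<open>auto intro!: finsum_closed simp: Pi_iff\<close>)
  also have "\<dots> = (\<Oplus>i\<in>I. M (t, i) \<otimes> c' i)" using expand[OF c'(1)] by simp
  also have "\<dots> = (\<Oplus>i\<in>I. M' (t, i) \<otimes> c' i)"
    using eq t c'(1) entry' In by (intro finsum_cong') (auto simp: Pi_iff)
  also have "\<dots> = M' (t, j)" using c'(2) t by simp
  finally show "M (t, j) = M' (t, j)" .
qed

text \<open>Union bound over the at most \<open>2 ^ n\<close> index sets \<open>I\<close> of size
  \<open>r\<close>; for each of them, restriction to the free entries is injective on the matrices
  spanned by the columns in \<open>I\<close>.\<close>

lemma card_Her_low_rank_le:
  assumes "r \<le> n"
  shows "card {M \<in> carrier (Her K q n). mat_rank K n M \<le> r} \<le> 2 ^ n * q ^ (r * (2 * n - r))"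
proof -
  let ?S = "\<lambda>I. {M \<in> carrier (Her K q n). col_spanned n I M}"
  let ?\<I> = "{I. I \<subseteq> {..<n} \<and> card I = r}"
  have fin\<I>: "finite ?\<I>" by (rule finite_subset[of _ "Pow {..<n}"]) auto
  have "card (?S I) \<le> q ^ (r * (2 * n - r))" if "I \<in> ?\<I>" for I
  proof -
    have I: "I \<subseteq> {..<n}" "card I = r" using that by auto
    have "inj_on (\<lambda>M. restrict M (free_entries n I)) (?S I)"
    proof (rule inj_onI)
      fix M M' assume MM: "M \<in> ?S I" "M' \<in> ?S I"
        and eq: "restrict M (free_entries n I) = restrict M' (free_entries n I)"
      show "M = M'"
        using Her_columns_determined[OF _ _ I(1) eq] MM I(1)
        by (intro Her_eq_if_col_spanned[of M n I M']) auto
    qed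
    moreover have "(\<lambda>M. restrict M (free_entries n I)) ` ?S I \<subseteq> PiE (free_entries n I) entry_range"
      using restrict_Her_in_PiE[OF _ I(1)] by blast
    moreover have "finite (PiE (free_entries n I) entry_range)"
      using card_free_entries_PiE[OF I(1)] q_gt_1
      by (metis card.infinite not_less_zero power_eq_0_iff)
    ultimately have "card (?S I) \<le> card (PiE (free_entries n I) entry_range)"
      by (rule card_inj_on_le)
    thus ?thesis using card_free_entries_PiE[OF I(1)] I(2) by simp
  qed
  hence "(\<Sum>I\<in>?\<I>. card (?S I)) \<le> card ?\<I> * q ^ (r * (2 * n - r))"
    using sum_bounded_above[of ?\<I> "\<lambda>I. card (?S I)" "q ^ (r * (2 * n - r))"] by simp
  moreover have "card ?\<I> \<le> 2 ^ n"
    using card_mono[of "Pow {..<n}" ?\<I>] by (auto simp: card_Pow)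
  moreover have "card {M \<in> carrier (Her K q n). mat_rank K n M \<le> r} \<le> card (\<Union>I\<in>?\<I>. ?S I)"
  proof (rule card_mono)
    show "finite (\<Union>I\<in>?\<I>. ?S I)" using fin\<I> finite_Her by auto
    show "{M \<in> carrier (Her K q n). mat_rank K n M \<le> r} \<subseteq> (\<Union>I\<in>?\<I>. ?S I)"
      using col_spanned_if_mat_rank_le[OF _ _ assms] Her_subset by blast
  qed
  moreover have "card (\<Union>I\<in>?\<I>. ?S I) \<le> (\<Sum>I\<in>?\<I>. card (?S I))" by (rule card_UN_le[OF fin\<I>])
  ultimately show ?thesis by (meson le_trans mult_le_mono1)
qed

end

section \<open>Lower bound for the number of Hermitian matrices of low rank\<close>

context hermitian_field
begin

text \<open>Support in the lower right block of size \<open>n - j\<close> makes an induction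
  possible that adds one row and column and one unit of rank at a time.\<close>

definition corner :: "nat \<Rightarrow> nat \<Rightarrow> nat \<Rightarrow> (nat \<times> nat \<Rightarrow> 'a) set" where
  "corner n j r = {M \<in> carrier (Her K q n). mat_rank K n M \<le> r \<and>
     (\<forall>i<n. \<forall>i'<n. i < j \<or> i' < j \<longrightarrow> M (i, i') = \<zero>)}"

lemma finite_corner: "finite (corner n j r)"
  unfolding corner_def using finite_Her by simp

text \<open>The injection sends \<open>(d, l, M)\<close> to \<open>d x x\<^sup>* + M\<close>, where \<open>x\<close> is \<open>0\<close> above position \<open>j\<close>, \<open>1\<close> at
  \<open>j\<close> and \<open>l\<close> below; column \<open>j\<close> of the result is \<open>d x\<close>.\<close>

lemma card_corner_step:
  assumes j: "j < n"
  shows "(q - 1) * q ^ (2 * (n - Suc j)) * card (corner n (Suc j) r) \<le> card (corner n j (Suc r))"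
proof -
  interpret V: vectorspace K "vec_module K n" by (rule func_space_vectorspace)
  define x where "x = (\<lambda>l i. if i = j then \<one> else if i < j then \<zero> else (l i :: 'a))"
  define \<Phi> where "\<Phi> = (\<lambda>(d, l, M). \<lambda>(i, i')\<in>{..<n} \<times> {..<n}. d \<otimes> (x l i \<otimes> bar (x l i')) \<oplus> M (i, i'))"
  let ?L = "{j<..<n} \<rightarrow>\<^sub>E carrier K"
  let ?A = "(Fq - {\<zero>}) \<times> ?L \<times> corner n (Suc j) r"
  have x: "x l i \<in> carrier K" if "l \<in> ?L" "i < n" for l i
    using that PiE_mem[of l "{j<..<n}" "\<lambda>_. carrier K" i] by (auto simp: x_def)
  have \<Phi>_app: "\<Phi> (d, l, M) (i, i') = d \<otimes> (x l i \<otimes> bar (x l i')) \<oplus> M (i, i')" if "i < n" "i' < n" for d l M i i'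
    using that by (simp add: \<Phi>_def)
  have low: "\<Phi> (d, l, M) \<in> corner n j (Suc r)"
    if d: "d \<in> Fq - {\<zero>}" and l: "l \<in> ?L" and M: "M \<in> corner n (Suc j) r" for d l M
  proof -
    have dK: "d \<in> carrier K" "bar d = d" using d by auto
    have MH: "M \<in> carrier (Her K q n)" and Mr: "mat_rank K n M \<le> r"
      and M0: "\<And>i i'. i < n \<Longrightarrow> i' < n \<Longrightarrow> i < Suc j \<or> i' < Suc j \<Longrightarrow> M (i, i') = \<zero>"
      using M by (auto simp: corner_def)
    have MP: "M \<in> {..<n} \<times> {..<n} \<rightarrow>\<^sub>E carrier K" using MH Her_subset by blast
    have \<Phi>P: "\<Phi> (d, l, M) \<in> {..<n} \<times> {..<n} \<rightarrow>\<^sub>E carrier K"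
      using x[OF l] dK Her_entry[OF MH] by (auto simp: \<Phi>_def)
    have "\<Phi> (d, l, M) \<in> carrier (Her K q n)"
      unfolding Her_iff
    proof (intro conjI \<Phi>P allI impI)
      fix i i' assume i: "i < n" "i' < n"
      let ?a = "x l i'" and ?b = "bar (x l i)"
      have K: "?a \<in> carrier K" "?b \<in> carrier K" "M (i', i) \<in> carrier K"
        using x[OF l] i Her_entry[OF MH] by auto
      have "bar (d \<otimes> (?a \<otimes> ?b) \<oplus> M (i', i)) = bar (d \<otimes> (?a \<otimes> ?b)) \<oplus> bar (M (i', i))"
        using dK(1) K by (intro bar_add m_closed)
      also have "bar (d \<otimes> (?a \<otimes> ?b)) = bar d \<otimes> bar (?a \<otimes> ?b)"
        using dK(1) K by (intro nat_pow_distrib m_closed)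
      also have "bar (?a \<otimes> ?b) = bar ?a \<otimes> bar ?b"
        using K by (intro nat_pow_distrib)
      also have "bar d \<otimes> (bar ?a \<otimes> bar ?b) \<oplus> bar (M (i', i)) = d \<otimes> (x l i \<otimes> bar (x l i')) \<oplus> M (i, i')"
        unfolding dK(2) bar_bar[OF x[OF l i(1)]] Her_sym[OF MH i]
          m_comm[OF nat_pow_closed[OF x[OF l i(2)]] x[OF l i(1)]] ..
      finally show "bar (\<Phi> (d, l, M) (i', i)) = \<Phi> (d, l, M) (i, i')"
        by (simp only: \<Phi>_app i)
    qed
    moreover have "\<Phi> (d, l, M) (i, i') = \<zero>" if "i < n" "i' < n" "i < j \<or> i' < j" for i i'
    proof -
      have "x l i = \<zero> \<or> x l i' = \<zero>" using that(3) by (auto simp: x_def)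
      thus ?thesis
        using that x[OF l that(1)] x[OF l that(2)] dK(1) M0[of i i'] by (auto simp: \<Phi>_app)
    qed
    moreover have "mat_rank K n (\<Phi> (d, l, M)) \<le> Suc r"
    proof -
      obtain U where U: "VectorSpace.subspace K U (vec_module K n)" "card U \<le> card (carrier K) ^ r"
          "\<forall>j<n. mat_col n M j \<in> U"
        using mat_rank_le_iff[OF MP] Mr by blast
      define w where "w = (\<lambda>i\<in>{..<n}. x l i)"
      have w: "w \<in> carrier (vec_module K n)" using x[OF l] by (auto simp: w_def)
      let ?U' = "V.adjoin U w"
      have U': "VectorSpace.subspace K ?U' (vec_module K n)" using V.subspace_adjoin[OF U(1) w] .
      \<comment> \<open>Only an upper bound is claimed, as \<open>w\<close> may already lie in
        \<open>U\<close>.\<close>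
      have "card ?U' \<le> card U * card (carrier K)"
        unfolding V.adjoin_def
        using card_image_le[of "U \<times> carrier K"] V.subspaceD(1)[OF U(1)] finite_K
          finite_subset[of U "{..<n} \<rightarrow>\<^sub>E carrier K"] finite_PiE[of "{..<n}" "\<lambda>_. carrier K"]
        by (auto simp: card_cartesian_product)
      also have "\<dots> \<le> card (carrier K) ^ Suc r" using U(2) by (simp add: mult.commute)
      finally have "card ?U' \<le> card (carrier K) ^ Suc r" .
      moreover have "mat_col n (\<Phi> (d, l, M)) i' \<in> ?U'" if i': "i' < n" for i'
      proof -
        let ?c = "d \<otimes> bar (x l i')"
        have cK: "?c \<in> carrier K" using dK x[OF l i'] by simp
        have "mat_col n (\<Phi> (d, l, M)) i' = mat_col n M i' \<oplus>\<^bsub>vec_module K n\<^esub> ?c \<odot>\<^bsub>vec_module K n\<^esub> w"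
        proof
          fix i
          show "mat_col n (\<Phi> (d, l, M)) i' i = (mat_col n M i' \<oplus>\<^bsub>vec_module K n\<^esub> ?c \<odot>\<^bsub>vec_module K n\<^esub> w) i"
            using i' dK x[OF l] Her_entry[OF MH]
            by (cases "i < n") (auto simp: mat_col_def \<Phi>_app w_def m_ac a_ac)
        qed
        thus ?thesis unfolding V.adjoin_def using U(3) i' cK
          by (intro image_eqI[of _ _ "(mat_col n M i', ?c)"]) auto
      qed
      ultimately show ?thesis using mat_rank_le_iff[OF \<Phi>P] U' by blast
    qed
    ultimately show ?thesis by (simp add: corner_def)
  qed
  have inj: "inj_on \<Phi> ?A"
  proof (rule inj_onI)
    fix y y' assume "y \<in> ?A" "y' \<in> ?A" and \<Phi>eq: "\<Phi> y = \<Phi> y'"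
    then obtain d l M d' l' M' where y: "y = (d, l, M)" "y' = (d', l', M')"
      and d: "d \<in> carrier K" "d \<noteq> \<zero>" and l: "l \<in> ?L" and M: "M \<in> corner n (Suc j) r"
      and d': "d' \<in> carrier K" "d' \<noteq> \<zero>" and l': "l' \<in> ?L" and M': "M' \<in> corner n (Suc j) r"
      by blast
    have eq: "\<Phi> (d, l, M) = \<Phi> (d', l', M')" using \<Phi>eq y by simp
    have H: "M \<in> carrier (Her K q n)" "M' \<in> carrier (Her K q n)" using M M' by (auto simp: corner_def)
    have col: "\<Phi> (d, l, M) (i, j) = d \<otimes> x l i"
      if "d \<in> carrier K" "l \<in> ?L" "M \<in> corner n (Suc j) r" "i < n" for d l M i
    proof -
      have "M (i, j) = \<zero>" using that j by (auto simp: corner_def)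
      moreover have "x l j = \<one>" by (simp add: x_def)
      ultimately show ?thesis using that j x[OF that(2,4)] by (simp add: \<Phi>_app)
    qed
    have c: "d \<otimes> x l i = d' \<otimes> x l' i" if "i < n" for i
      using col[OF d(1) l M that] col[OF d'(1) l' M' that] eq by simp
    \<comment> \<open>Row \<open>j\<close> of column \<open>j\<close> reveals \<open>d\<close>,
      since \<open>x\<close> is \<open>\<one>\<close> there; cancelling \<open>d\<close> reveals
      \<open>l\<close>, and subtracting the rank one part reveals \<open>M\<close>.\<close>
    have dd: "d = d'" using c[OF j] d d' by (simp add: x_def)
    have xx: "x l i = x l' i" if "i < n" for i
      using c[OF that] dd d x[OF l that] x[OF l' that] m_lcancel by auto
    have ll: "l = l'"
    proof (rule PiE_ext[OF l l'])
      fix i assume "i \<in> {j<..<n}"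
      thus "l i = l' i" using xx[of i] by (simp add: x_def)
    qed
    have "M = M'"
    proof (rule Her_eqI[OF H])
      fix i i' assume i: "i < n" "i' < n"
      let ?y = "d \<otimes> (x l i \<otimes> bar (x l i'))"
      have "?y \<oplus> M (i, i') = ?y \<oplus> M' (i, i')"
        using fun_cong[OF eq, of "(i, i')"] i dd ll by (simp add: \<Phi>_app)
      moreover have "?y \<in> carrier K" using x[OF l] i d(1) by auto
      ultimately show "M (i, i') = M' (i, i')"
        using Her_entry[OF H(1) i] Her_entry[OF H(2) i] by (metis r_neg1)
    qed
    thus "y = y'" using y dd ll by simp
  qed
  have "card ?A = card (Fq - {\<zero>}) * (card ?L * card (corner n (Suc j) r))"
    by (simp only: card_cartesian_product)
  also have "card (Fq - {\<zero>}) = q - 1" using card_Fq q_gt_1 by (subst card_Diff_singleton) auto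
  also have "card ?L = q ^ (2 * (n - Suc j))" by (simp add: card_PiE card_K power_mult)
  finally have "(q - 1) * q ^ (2 * (n - Suc j)) * card (corner n (Suc j) r) = card ?A"
    by (simp add: mult.assoc)
  also have "\<dots> \<le> card (corner n j (Suc r))"
    using inj low finite_corner by (intro card_inj_on_le[of \<Phi>]) auto
  finally show ?thesis .
qed

text \<open>Iterating the step from the zero matrix, the exponents 2(n-j-1), 2(n-j-2), ... of
  \<open>q\<close> add up to r(2(n-j)-r-1) over \<open>r\<close> steps.\<close>

lemma card_corner_ge:
  assumes "j + r \<le> n"
  shows "(q - 1) ^ r * q ^ (r * (2 * (n - j) - r - 1)) \<le> card (corner n j r)"
  using assms
proof (induction r arbitrary: j)
  case 0
  have "(\<lambda>v\<in>{..<n} \<times> {..<n}. \<zero>) \<in> corner n j 0"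
  proof -
    interpret V: vectorspace K "vec_module K n" by (rule func_space_vectorspace)
    let ?Z = "\<lambda>v\<in>{..<n} \<times> {..<n}. \<zero>"
    have Z: "?Z \<in> {..<n} \<times> {..<n} \<rightarrow>\<^sub>E carrier K" by auto
    have "VectorSpace.subspace K {\<zero>\<^bsub>vec_module K n\<^esub>} (vec_module K n)" by (rule V.subspaceI) auto
    moreover have "mat_col n ?Z j \<in> {\<zero>\<^bsub>vec_module K n\<^esub>}" if "j < n" for j
      using that by (auto simp: mat_col_def)
    moreover have "card {\<zero>\<^bsub>vec_module K n\<^esub>} \<le> card (carrier K) ^ 0" by simp
    ultimately have "mat_rank K n ?Z \<le> 0" using mat_rank_le_iff[OF Z] by blast
    moreover have "?Z \<in> carrier (Her K q n)" unfolding Her_iff using q_gt_1 by auto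
    ultimately show ?thesis by (auto simp: corner_def)
  qed
  hence "card (corner n j 0) > 0" using finite_corner by (auto simp: card_gt_0_iff)
  thus ?case by simp
next
  case (Suc r)
  have j: "j < n" using Suc.prems by simp
  obtain s where s: "n = j + Suc r + s" using Suc.prems le_Suc_ex by blast
  have e: "2 * (n - Suc j) + r * (2 * (n - Suc j) - r - 1) = Suc r * (2 * (n - j) - Suc r - 1)"
    \<comment> \<open>For \<open>r = 0\<close> the subtraction on the left may truncate, but it is
      multiplied by zero.\<close>
    unfolding s by (cases r) (simp_all add: algebra_simps)
  have "(q - 1) ^ Suc r * q ^ (Suc r * (2 * (n - j) - Suc r - 1))
      = (q - 1) * q ^ (2 * (n - Suc j)) * ((q - 1) ^ r * q ^ (r * (2 * (n - Suc j) - r - 1)))"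
    unfolding e[symmetric] power_add by (simp add: ac_simps)
  also have "\<dots> \<le> (q - 1) * q ^ (2 * (n - Suc j)) * card (corner n (Suc j) r)"
    using Suc.IH[of "Suc j"] Suc.prems by (intro mult_left_mono) auto
  also have "\<dots> \<le> card (corner n j (Suc r))" by (rule card_corner_step[OF j])
  finally show ?case .
qed

text \<open>Since \<open>q \<le> 2 * (q - 1)\<close>, replacing each factor \<open>q - 1\<close> by
  \<open>q\<close> costs at most \<open>2 ^ r\<close>.\<close>

lemma card_Her_low_rank_ge:
  assumes "r \<le> n"
  shows "real q ^ (r * (2 * n - r)) \<le> 2 ^ r * real (card {M \<in> carrier (Her K q n). mat_rank K n M \<le> r})"
proof -
  have "(q - 1) ^ r * q ^ (r * (2 * n - r - 1)) \<le> card (corner n 0 r)"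
    using card_corner_ge[of 0 r n] assms by simp
  also have "\<dots> \<le> card {M \<in> carrier (Her K q n). mat_rank K n M \<le> r}"
    using finite_Her by (intro card_mono) (auto simp: corner_def)
  finally have le: "(q - 1) ^ r * q ^ (r * (2 * n - r - 1)) \<le> card {M \<in> carrier (Her K q n). mat_rank K n M \<le> r}" .
  have "r * (2 * n - r) = r + r * (2 * n - r - 1)"
    using assms by (cases "2 * n - r") auto
  hence "q ^ (r * (2 * n - r)) = q ^ r * q ^ (r * (2 * n - r - 1))" by (simp add: power_add)
  also have "\<dots> \<le> (2 * (q - 1)) ^ r * q ^ (r * (2 * n - r - 1))"
    using q_gt_1 by (intro mult_right_mono power_mono) auto
  also have "\<dots> = 2 ^ r * ((q - 1) ^ r * q ^ (r * (2 * n - r - 1)))" by (simp add: power_mult_distrib)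
  also have "\<dots> \<le> 2 ^ r * card {M \<in> carrier (Her K q n). mat_rank K n M \<le> r}"
    using le by simp
  finally have "real (q ^ (r * (2 * n - r))) \<le> real (2 ^ r * card {M \<in> carrier (Her K q n). mat_rank K n M \<le> r})"
    by (simp only: of_nat_le_iff)
  thus ?thesis by simp
qed

end

section \<open>Density of rank-metric codes\<close>

lemma delta_Her_nonneg: "0 \<le> delta_Her K q n k d"
  by (simp add: delta_Her_def)

context hermitian_field
begin

lemma finite_vectorspace_Her: "finite_vectorspace (base_field K q) (Her K q n) q (n\<^sup>2)"
proof -
  interpret vectorspace "base_field K q" "Her K q n" by (rule vectorspace_Her)
  show ?thesis
    by unfold_locales (use finite_Her card_Fq q_gt_1 card_Her in auto)
qed

text \<open>Because \<open>q > 1\<close>, a subspace has dimension \<open>k\<close> exactly if it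
  has \<open>q ^ k\<close> elements.\<close>

lemma Her_subspaces_eq:
  "Her_subspaces K q n k = finite_vectorspace.subspaces_over (base_field K q) (Her K q n) q k {\<zero>\<^bsub>Her K q n\<^esub>}"
proof -
  interpret H: finite_vectorspace "base_field K q" "Her K q n" q "n\<^sup>2" by (rule finite_vectorspace_Her)
  have "vectorspace.dim (base_field K q) ((Her K q n)\<lparr>carrier := W\<rparr>) = k \<longleftrightarrow> card W = q ^ k"
    if "VectorSpace.subspace (base_field K q) W (Her K q n)" for W
    using H.card_subspace[OF that finite_Her] card_Fq q_gt_1 by simp
  thus ?thesis using H.subspaceD(2) unfolding Her_subspaces_def H.subspaces_over_def by blast
qed

section \<open>Explicit bounds on the density for a fixed prime power\<close>

context
  fixes n d k :: nat
  assumes d2: "2 \<le> d" and dn: "d \<le> n" and k1: "1 \<le> k" and kn: "k \<le> n\<^sup>2"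
begin

interpretation H: finite_vectorspace "base_field K q" "Her K q n" q "n\<^sup>2" by (rule finite_vectorspace_Her)

definition low_rank :: "(nat \<times> nat \<Rightarrow> 'a) set" where
  "low_rank = {M \<in> carrier (Her K q n) - {\<zero>\<^bsub>Her K q n\<^esub>}. mat_rank K n M \<le> d - 1}"

abbreviation "D \<equiv> (d - 1) * (2 * n - (d - 1))"
abbreviation "all_subspaces \<equiv> H.subspaces_over k {\<zero>\<^bsub>Her K q n\<^esub>}"

text \<open>The subspaces counted in the numerator are those that avoid \<open>low_rank\<close>, so
  both moment bounds apply with \<open>low_rank\<close> as \<open>B\<close>.\<close>

lemma delta_Her_eq:
  "delta_Her K q n k d = real (card {W \<in> all_subspaces. low_rank \<inter> W = {}}) / real (card all_subspaces)"
proof -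
  have "{W \<in> all_subspaces. \<forall>M\<in>W. M \<noteq> \<zero>\<^bsub>Her K q n\<^esub> \<longrightarrow> d \<le> mat_rank K n M} = {W \<in> all_subspaces. low_rank \<inter> W = {}}"
  proof (rule Collect_cong, rule conj_cong[OF refl])
    fix W assume "W \<in> all_subspaces"
    hence "W \<subseteq> carrier (Her K q n)" using H.subspaceD(1) by (auto simp only: H.subspaces_over_def mem_Collect_eq)
    moreover have "mat_rank K n M \<le> d - 1 \<longleftrightarrow> \<not> d \<le> mat_rank K n M" for M using d2 by linarith
    ultimately show "(\<forall>M\<in>W. M \<noteq> \<zero>\<^bsub>Her K q n\<^esub> \<longrightarrow> d \<le> mat_rank K n M) \<longleftrightarrow> low_rank \<inter> W = {}"
      unfolding low_rank_def by blast
  qed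
  thus ?thesis unfolding delta_Her_def Her_subspaces_eq by simp
qed

lemma card_all_subspaces_pos: "real (card all_subspaces) > 0"
  using H.card_subspaces_over_zero[of k] H.num_over_pos[OF kn, of 0] by simp

lemma card_low_rank_le: "real (card low_rank) \<le> 2 ^ n * real q ^ D"
proof -
  have "card low_rank \<le> card {M \<in> carrier (Her K q n). mat_rank K n M \<le> d - 1}"
    using finite_Her by (intro card_mono) (auto simp: low_rank_def)
  also have "\<dots> \<le> 2 ^ n * q ^ D" using dn by (intro card_Her_low_rank_le) auto
  finally have "real (card low_rank) \<le> real (2 ^ n * q ^ D)" by (simp only: of_nat_le_iff)
  thus ?thesis by simp
qed

text \<open>The earlier lower bound also counts the zero matrix. Discarding it costs at most a
  factor 2, because at least two matrices are counted.\<close>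

lemma card_low_rank_ge: "real q ^ D \<le> 2 ^ d * real (card low_rank)"
proof -
  let ?Low = "{M \<in> carrier (Her K q n). mat_rank K n M \<le> d - 1}"
  have ge: "real q ^ D \<le> 2 ^ (d - 1) * real (card ?Low)"
    using dn by (intro card_Her_low_rank_ge) auto
  have "?Low \<subseteq> insert \<zero>\<^bsub>Her K q n\<^esub> low_rank" by (auto simp: low_rank_def)
  moreover have finB: "finite low_rank" unfolding low_rank_def using finite_Her by simp
  ultimately have "card ?Low \<le> card (insert \<zero>\<^bsub>Her K q n\<^esub> low_rank)" by (intro card_mono) auto
  also have "\<dots> \<le> Suc (card low_rank)" using finB by (simp add: card_insert_if)
  finally have B: "card ?Low \<le> Suc (card low_rank)" .
  \<comment> \<open>Hence \<open>q ^ D\<close> is at least \<open>2 ^ (d - 1) * 2\<close>, and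
    \<open>ge\<close> leaves at least two elements in \<open>?Low\<close>.\<close>
  have "(d - 1) + 1 \<le> D"
  proof -
    have "(d - 1) * 2 \<le> D" using dn d2 by (intro mult_left_mono) auto
    thus ?thesis using d2 by linarith
  qed
  hence "(2::real) ^ (d - 1 + 1) \<le> 2 ^ D" by (rule power_increasing) simp
  also have "\<dots> \<le> real q ^ D" using q_gt_1 by (intro power_mono) auto
  also note ge
  finally have "2 ^ (d - 1) * 2 \<le> 2 ^ (d - 1) * real (card ?Low)"
    by (simp only: power_add power_one_right)
  hence "card ?Low \<ge> 2" by simp
  hence "card ?Low \<le> 2 * card low_rank" using B by linarith
  hence "2 ^ (d - 1) * real (card ?Low) \<le> 2 ^ (d - 1) * real (2 * card low_rank)" by (simp del: of_nat_mult)
  also have "\<dots> = 2 ^ d * real (card low_rank)" using d2 by (cases d) auto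
  finally show ?thesis using ge by simp
qed

lemma incl_prob_le: "H.incl_prob k \<le> real q ^ k / real q ^ n\<^sup>2"
proof -
  have "real q ^ k \<le> real q ^ n\<^sup>2" using kn q_gt_1 by (intro power_increasing) auto
  moreover have "real q ^ n\<^sup>2 > 1" using q_gt_1 d2 dn by (intro one_less_power) auto
  moreover have "(a - 1) / (b - 1) \<le> a / b" if "a \<le> b" "1 < b" for a b :: real
    using that by (simp add: field_simps)
  ultimately show ?thesis unfolding H.incl_prob_def by blast
qed

lemma incl_prob_ge: "real q ^ k / (2 * real q ^ n\<^sup>2) \<le> H.incl_prob k"
proof -
  have "2 \<le> real q" using q_gt_1 by simp
  moreover have "real q \<le> real q ^ k" using power_increasing[of 1 k "real q"] q_gt_1 k1 by simp
  ultimately have "real q ^ k / 2 \<le> real q ^ k - 1" by linarith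
  moreover have "real q ^ n\<^sup>2 > 1" using q_gt_1 d2 dn by (intro one_less_power) auto
  ultimately have "(real q ^ k / 2) / real q ^ n\<^sup>2 \<le> (real q ^ k - 1) / (real q ^ n\<^sup>2 - 1)"
    by (intro frac_le) auto
  thus ?thesis by (simp add: H.incl_prob_def)
qed

lemma delta_Her_le_1: "delta_Her K q n k d \<le> 1"
proof -
  have "card {W \<in> all_subspaces. low_rank \<inter> W = {}} \<le> card all_subspaces"
    using H.finite_subspaces_over by (intro card_mono) auto
  thus ?thesis unfolding delta_Her_eq using card_all_subspaces_pos by (simp only: divide_le_eq_1_pos of_nat_le_iff)
qed

text \<open>An integer, since the exponent may be negative.\<close>

abbreviation "e \<equiv> (int n)\<^sup>2 - int k + 1 - (int d - 1) * (2 * int n - int d + 1)"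

lemma e_eq: "e = int (n\<^sup>2) - int k + 1 - int D"
proof -
  have "int (d - 1) = int d - 1" "int (2 * n - (d - 1)) = 2 * int n - int d + 1" using d2 dn by auto
  thus ?thesis by (simp only: of_nat_mult of_nat_power)
qed

text \<open>The first moment bound for the subspaces that meet \<open>low_rank\<close>. The constant
  is \<open>2 ^ n\<close> from the size of \<open>low_rank\<close>, times 2 from
  \<open>q - 1 \<ge> q / 2\<close>.\<close>

lemma one_minus_delta_Her_le: "1 - delta_Her K q n k d \<le> 2 ^ (n + 1) * real q powi (- e)"
proof -
  let ?G = "real (card all_subspaces)" and ?Y = "real (card {W \<in> all_subspaces. low_rank \<inter> W \<noteq> {}})"
  have q0: "real q > 0" using q_gt_1 by simp
  have "card all_subspaces = card ({W \<in> all_subspaces. low_rank \<inter> W = {}} \<union> {W \<in> all_subspaces. low_rank \<inter> W \<noteq> {}})"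
    by (rule arg_cong[of _ _ card]) auto
  also have "\<dots> = card {W \<in> all_subspaces. low_rank \<inter> W = {}} + card {W \<in> all_subspaces. low_rank \<inter> W \<noteq> {}}"
    using H.finite_subspaces_over by (intro card_Un_disjoint) auto
  finally have "1 - delta_Her K q n k d = ?Y / ?G"
    unfolding delta_Her_eq using card_all_subspaces_pos by (simp add: field_simps)
  moreover have "?Y * (real q - 1) \<le> real (card low_rank) * H.incl_prob k * ?G"
  proof (rule H.first_moment_bound[OF k1 kn])
    show "low_rank \<subseteq> carrier (Her K q n) - {\<zero>\<^bsub>Her K q n\<^esub>}" by (auto simp: low_rank_def)
    fix c v assume c: "c \<in> carrier (base_field K q) - {\<zero>\<^bsub>base_field K q\<^esub>}" and v: "v \<in> low_rank"
    have vH: "v \<in> carrier (Her K q n)" "v \<noteq> \<zero>\<^bsub>Her K q n\<^esub>" "mat_rank K n v \<le> d - 1"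
      using v by (auto simp: low_rank_def)
    have "c \<odot>\<^bsub>Her K q n\<^esub> v \<noteq> \<zero>\<^bsub>Her K q n\<^esub>"
    proof
      assume 0: "c \<odot>\<^bsub>Her K q n\<^esub> v = \<zero>\<^bsub>Her K q n\<^esub>"
      have "v = inv\<^bsub>base_field K q\<^esub> c \<odot>\<^bsub>Her K q n\<^esub> \<zero>\<^bsub>Her K q n\<^esub>"
        using H.mult_inverse[OF _ vH(1) 0] c by blast
      thus False using vH(2) c H.rmult_0 H.inverse_exists by (metis DiffE singletonI)
    qed
    moreover have "c \<odot>\<^bsub>Her K q n\<^esub> v \<in> carrier (Her K q n)" using c vH(1) by (intro H.smult_closed) auto
    moreover have "mat_rank K n (c \<odot>\<^bsub>Her K q n\<^esub> v) \<le> d - 1"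
      unfolding Her_sel(2) using mat_rank_smult[of v n c] vH c Her_subset by (auto intro: order_trans)
    ultimately show "c \<odot>\<^bsub>Her K q n\<^esub> v \<in> low_rank" unfolding low_rank_def by blast
  qed
  ultimately have "(1 - delta_Her K q n k d) * (real q - 1) \<le> real (card low_rank) * H.incl_prob k"
    using card_all_subspaces_pos by (simp only: times_divide_eq_left pos_divide_le_eq)
  also have "\<dots> \<le> (2 ^ n * real q ^ D) * (real q ^ k / real q ^ n\<^sup>2)"
    using card_low_rank_le incl_prob_le H.incl_prob_def q_gt_1
    by (intro mult_mono) (auto intro!: divide_nonneg_nonneg)
  finally have 1: "(1 - delta_Her K q n k d) * (real q - 1) \<le> (2 ^ n * real q ^ D) * (real q ^ k / real q ^ n\<^sup>2)" .
  have "(1 - delta_Her K q n k d) * (real q / 2) \<le> (1 - delta_Her K q n k d) * (real q - 1)"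
    using delta_Her_le_1 q_gt_1 by (intro mult_left_mono) auto
  from order_trans[OF this 1]
  have "1 - delta_Her K q n k d \<le> 2 * ((2 ^ n * real q ^ D) * (real q ^ k / real q ^ n\<^sup>2)) / real q"
    unfolding pos_le_divide_eq[OF q0] by linarith
  also have "\<dots> = 2 ^ (n + 1) * (real q ^ D * real q ^ k / real q ^ n\<^sup>2 / real q)" by simp
  also have "real q ^ D * real q ^ k / real q ^ n\<^sup>2 / real q = real q powi (int D + int k - int (n\<^sup>2) - 1)"
    using q0 by (simp add: power_int_diff power_int_add del: of_nat_mult of_nat_power)
  also have "int D + int k - int (n\<^sup>2) - 1 = - e" unfolding e_eq by simp
  finally show ?thesis .
qed

text \<open>The second moment bound for the subspaces that avoid \<open>low_rank\<close>. The
  constant is \<open>2 ^ d\<close> from the size of \<open>low_rank\<close>, times 2 from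
  \<open>incl_prob_ge\<close>.\<close>

lemma delta_Her_le:
  assumes k2: "2 \<le> k"
  shows "delta_Her K q n k d \<le> 2 ^ (d + 1) * real q powi e"
proof -
  let ?\<delta> = "delta_Her K q n k d"
  have q0: "real q > 0" using q_gt_1 by simp
  have "low_rank \<subseteq> carrier (Her K q n) - {\<zero>\<^bsub>Her K q n\<^esub>}" by (auto simp: low_rank_def)
  from H.second_moment_bound[OF k2 kn this]
  have "?\<delta> * (real (card low_rank) * H.incl_prob k) \<le> real q - 1"
    unfolding delta_Her_eq using card_all_subspaces_pos by (simp add: field_simps)
  moreover have "?\<delta> * ((real q ^ D / 2 ^ d) * (real q ^ k / (2 * real q ^ n\<^sup>2))) \<le> ?\<delta> * (real (card low_rank) * H.incl_prob k)"
    using card_low_rank_ge incl_prob_ge delta_Her_nonneg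
    by (intro mult_left_mono mult_mono) (auto simp: field_simps)
  ultimately have "?\<delta> * ((real q ^ D / 2 ^ d) * (real q ^ k / (2 * real q ^ n\<^sup>2))) \<le> real q" by linarith
  hence "?\<delta> \<le> 2 ^ (d + 1) * (real q ^ n\<^sup>2 * real q / real q ^ k / real q ^ D)"
    using q0 by (simp add: field_simps)
  also have "real q ^ n\<^sup>2 * real q / real q ^ k / real q ^ D = real q powi (int (n\<^sup>2) + 1 - int k - int D)"
    using q0 by (simp add: power_int_diff power_int_add del: of_nat_mult of_nat_power)
  also have "int (n\<^sup>2) + 1 - int k - int D = e" unfolding e_eq by simp
  finally show ?thesis .
qed

end

end

text \<open>The two bounds for fixed \<open>q\<close> have constants independent of
  \<open>q\<close>, so the sign of the exponent decides the limit.\<close>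

theorem theorem6p20:
  fixes F :: "nat \<Rightarrow> 'a ring" and n d k :: nat
  assumes "\<And>q. primepow q \<Longrightarrow> field (F q)"
    and "\<And>q. primepow q \<Longrightarrow> order (F q) = q\<^sup>2"
    and "2 \<le> n" and "2 \<le> d" and "d \<le> n"
    and "1 \<le> k" and "k \<le> n * (n - d + 1)"
  shows "(\<lambda>q. delta_Her (F q) q n k d) \<in> O[primepow_at_top](\<lambda>q. real q powi
           ((int n)\<^sup>2 - int k + 1 - (int d - 1) * (2 * int n - int d + 1)))
    \<and> (int k < (int n)\<^sup>2 + 1 - (int d - 1) * (2 * int n - int d + 1)
         \<longrightarrow> ((\<lambda>q. delta_Her (F q) q n k d) \<longlongrightarrow> 1) primepow_at_top)
    \<and> (int k > (int n)\<^sup>2 + 1 - (int d - 1) * (2 * int n - int d + 1)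
         \<longrightarrow> ((\<lambda>q. delta_Her (F q) q n k d) \<longlongrightarrow> 0) primepow_at_top)"
proof -
  let ?\<delta> = "\<lambda>q. delta_Her (F q) q n k d"
  define e where "e = (int n)\<^sup>2 - int k + 1 - (int d - 1) * (2 * int n - int d + 1)"
  have hf: "hermitian_field (F q) q" if "primepow q" for q
    using assms(1,2)[OF that] that by (simp add: hermitian_field_def hermitian_field_axioms_def)
  have "n * (n - d + 1) \<le> n\<^sup>2"
    unfolding power2_eq_square using assms(3-5) by (intro mult_left_mono) auto
  hence kn: "k \<le> n\<^sup>2" using assms(7) by simp
  note bounds = hermitian_field.delta_Her_le_1[OF hf assms(4-6) kn]
    hermitian_field.one_minus_delta_Her_le[OF hf assms(4-6) kn, folded e_def]
    hermitian_field.delta_Her_le[OF hf assms(4-6) kn, folded e_def]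
  \<comment> \<open>Completing the square gives e = (n-d+1)^2 + 1 - k with a positive square, so the
    second moment bound is available whenever \<open>e\<close> is negative.\<close>
  have k2: "2 \<le> k" if "e < 0"
  proof -
    have "e = (int n - int d + 1)\<^sup>2 + 1 - int k"
      unfolding e_def by (simp add: power2_eq_square algebra_simps)
    moreover have "(int n - int d + 1)\<^sup>2 \<ge> 1" using assms(5) by simp
    ultimately show ?thesis using that by linarith
  qed
  have ev: "eventually P primepow_at_top" if "\<And>q. primepow q \<Longrightarrow> P q" for P
    unfolding primepow_at_top_def eventually_inf_principal using that by auto
  have inv0: "((\<lambda>q. C / real q) \<longlongrightarrow> 0) primepow_at_top" for C
  proof (rule tendsto_mono)
    show "primepow_at_top \<le> at_top" unfolding primepow_at_top_def by simp
    show "((\<lambda>q. C / real q) \<longlongrightarrow> 0) at_top"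
      by (rule tendsto_divide_0[OF tendsto_const filterlim_at_top_imp_at_infinity[OF filterlim_real_sequentially]])
  qed
  have pow: "real q powi a \<le> 1 / real q" if "primepow q" "a < 0" for q :: nat and a :: int
  proof -
    have "real q powi a \<le> real q powi (- 1)"
      using that primepow_gt_Suc_0[of q] by (intro power_int_increasing) auto
    thus ?thesis by (simp add: power_int_minus inverse_eq_divide)
  qed
  have "?\<delta> \<in> O[primepow_at_top](\<lambda>q. real q powi e)"
  proof (rule bigoI[where c = "2 ^ (d + 1)"], rule ev)
    fix q :: nat assume q: "primepow q"
    have q1: "real q \<ge> 1" using primepow_gt_Suc_0[OF q] by simp
    have "?\<delta> q \<le> 2 ^ (d + 1) * real q powi e"
    \<comment> \<open>For nonnegative \<open>e\<close> the trivial bound by 1 suffices, as then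
      \<open>real q powi e\<close> is at least 1.\<close>
    proof (cases "e < 0")
      case True
      thus ?thesis using bounds(3)[OF q] k2 by simp
    next
      case False
      have "real q powi 0 \<le> real q powi e"
        using q1 False by (intro power_int_increasing) auto
      moreover have "(1::real) \<le> 2 ^ (d + 1)" by (rule one_le_power) simp
      ultimately have "1 * 1 \<le> 2 ^ (d + 1) * real q powi e" by (intro mult_mono) auto
      thus ?thesis using bounds(1)[OF q] by linarith
    qed
    thus "norm (?\<delta> q) \<le> 2 ^ (d + 1) * norm (real q powi e)"
      using delta_Her_nonneg[of "F q" q n k d] q1 by (simp add: abs_of_nonneg)
  qed
  moreover have "(?\<delta> \<longlongrightarrow> 1) primepow_at_top" if "e > 0"
  proof -
    have "((\<lambda>q. 1 - ?\<delta> q) \<longlongrightarrow> 0) primepow_at_top"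
    proof (rule tendsto_sandwich[OF _ _ tendsto_const inv0[of "2 ^ (n + 1)"]]; rule ev)
      fix q :: nat assume q: "primepow q"
      show "0 \<le> 1 - ?\<delta> q" using bounds(1)[OF q] by simp
      have "2 ^ (n + 1) * real q powi (- e) \<le> 2 ^ (n + 1) * (1 / real q)"
        using pow[OF q, of "- e"] that by (intro mult_left_mono) auto
      thus "1 - ?\<delta> q \<le> 2 ^ (n + 1) / real q" using bounds(2)[OF q] by simp
    qed
    from tendsto_diff[OF tendsto_const[of 1] this] show ?thesis by simp
  qed
  moreover have "(?\<delta> \<longlongrightarrow> 0) primepow_at_top" if "e < 0"
  proof (rule tendsto_sandwich[OF _ _ tendsto_const inv0[of "2 ^ (d + 1)"]]; rule ev)
    fix q :: nat assume q: "primepow q"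
    show "0 \<le> ?\<delta> q" using delta_Her_nonneg[of "F q" q n k d] .
    have "2 ^ (d + 1) * real q powi e \<le> 2 ^ (d + 1) * (1 / real q)"
      using pow[OF q that] by (intro mult_left_mono) auto
    thus "?\<delta> q \<le> 2 ^ (d + 1) / real q" using bounds(3)[OF q k2[OF that]] by simp
  qed
  ultimately show ?thesis unfolding e_def by simp
qed

end
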